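(* Let $L>0$ and let $P\in C^1[0,L]$ be real-valued with $P^0\le P(x)\le P^1$ for all $x\in[0,L]$, for positive constants $P^0,P^1$. For $\tau>1$ let $\phi_1,\phi_2$ be any two linearly independent solutions of $y''+\frac{\tau^2}{P(x)}y=0$ on $(0,L)$, and define the Green's function $$J_\tau(x,t)=\frac{\phi_1(x)\phi_2(t)-\phi_2(x)\phi_1(t)}{\phi_1'(t)\phi_2(t)-\phi_1(t)\phi_2'(t)},\qquad x,t\in[0,L].$$ Then there exists a constant $C>0$ such that for all $f\in H^1(0,L)$ and all $\tau>1$, $$\Big\|\int_0^x f(t)J_\tau(x,t)\,dt\Big\|_{L^\infty(0,L)}\le\frac{C}{\tau^2}\|f\|_{H^1},\qquad \Big\|\int_0^x f(t)\partial_xJ_\tau(x,t)\,dt\Big\|_{L^\infty(0,L)}\le\frac{C}{\tau}\|f\|_{H^1},$$ where the $L^\infty$ norms are taken in the variable $x$.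
   Context: The Wronskian in the denominator is constant in $t$, and $J_\tau$ does not depend on the choice of the basis $\phi_1,\phi_2$ (it is the solution in $x$ with $J_\tau(t,t)=0$, $\partial_xJ_\tau(t,t)=1$). *)

theory Defs
  imports "HOL-Analysis.Analysis"
begin

definition C1_on_interval :: "real \<Rightarrow> real \<Rightarrow> (real \<Rightarrow> real) \<Rightarrow> bool" where
  "C1_on_interval a b P \<longleftrightarrow>
     (\<exists>P'. (\<forall>x\<in>{a..b}. (P has_real_derivative P' x) (at x within {a..b}))
           \<and> continuous_on {a..b} P')"

text \<open>phi (with derivative dphi) solves y'' + tau^2/P(x) y = 0 on [0,L] (the solutions on (0,L)
  extend as C^2 solutions to the closed interval since P is continuous and positive there).\<close>
definition is_solution :: "real \<Rightarrow> (real \<Rightarrow> real) \<Rightarrow> real \<Rightarrow> (real \<Rightarrow> real) \<Rightarrow> (real \<Rightarrow> real) \<Rightarrow> bool" where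
  "is_solution L P \<tau> phi dphi \<longleftrightarrow>
     (\<forall>x\<in>{0..L}. (phi has_real_derivative dphi x) (at x within {0..L})
        \<and> (dphi has_real_derivative (- (\<tau>\<^sup>2 / P x) * phi x)) (at x within {0..L}))"

definition lin_indep_on :: "real \<Rightarrow> (real \<Rightarrow> real) \<Rightarrow> (real \<Rightarrow> real) \<Rightarrow> bool" where
  "lin_indep_on L phi1 phi2 \<longleftrightarrow>
     (\<forall>a b::real. (\<forall>x\<in>{0<..<L}. a * phi1 x + b * phi2 x = 0) \<longrightarrow> a = 0 \<and> b = 0)"

definition greenJ :: "(real \<Rightarrow> real) \<Rightarrow> (real \<Rightarrow> real) \<Rightarrow> (real \<Rightarrow> real) \<Rightarrow> (real \<Rightarrow> real)
     \<Rightarrow> real \<Rightarrow> real \<Rightarrow> real" where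
  "greenJ phi1 phi2 dphi1 dphi2 x t =
     (phi1 x * phi2 t - phi2 x * phi1 t) / (dphi1 t * phi2 t - phi1 t * dphi2 t)"

definition greenJ_dx :: "(real \<Rightarrow> real) \<Rightarrow> (real \<Rightarrow> real) \<Rightarrow> (real \<Rightarrow> real) \<Rightarrow> (real \<Rightarrow> real)
     \<Rightarrow> real \<Rightarrow> real \<Rightarrow> real" where
  "greenJ_dx phi1 phi2 dphi1 dphi2 x t =
     (dphi1 x * phi2 t - dphi2 x * phi1 t) / (dphi1 t * phi2 t - phi1 t * dphi2 t)"

definition test_fun :: "real \<Rightarrow> (real \<Rightarrow> real) \<Rightarrow> bool" where
  "test_fun L \<psi> \<longleftrightarrow>
     (\<forall>n x. ((deriv ^^ n) \<psi>) differentiable (at x))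
     \<and> compact (closure {x. \<psi> x \<noteq> 0}) \<and> closure {x. \<psi> x \<noteq> 0} \<subseteq> {0<..<L}"

definition L2_on :: "real \<Rightarrow> (real \<Rightarrow> real) \<Rightarrow> bool" where
  "L2_on L f \<longleftrightarrow> f \<in> borel_measurable (lebesgue_on {0<..<L})
                  \<and> integrable (lebesgue_on {0<..<L}) (\<lambda>x. (f x)\<^sup>2)"

definition weak_deriv_H1 :: "real \<Rightarrow> (real \<Rightarrow> real) \<Rightarrow> (real \<Rightarrow> real) \<Rightarrow> bool" where
  "weak_deriv_H1 L f g \<longleftrightarrow> L2_on L f \<and> L2_on L g \<and>
     (\<forall>\<psi>. test_fun L \<psi> \<longrightarrow>
        integral\<^sup>L (lebesgue_on {0<..<L}) (\<lambda>x. f x * deriv \<psi> x)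
        = - integral\<^sup>L (lebesgue_on {0<..<L}) (\<lambda>x. g x * \<psi> x))"

definition in_H1 :: "real \<Rightarrow> (real \<Rightarrow> real) \<Rightarrow> bool" where
  "in_H1 L f \<longleftrightarrow> (\<exists>g. weak_deriv_H1 L f g)"

text \<open>H^1 norm: (||f||_2^2 + ||f'||_2^2)^(1/2) (well defined: weak derivatives agree a.e.).\<close>
definition H1_norm :: "real \<Rightarrow> (real \<Rightarrow> real) \<Rightarrow> real" where
  "H1_norm L f = sqrt (integral\<^sup>L (lebesgue_on {0<..<L}) (\<lambda>x. (f x)\<^sup>2)
       + integral\<^sup>L (lebesgue_on {0<..<L}) (\<lambda>x. ((SOME g. weak_deriv_H1 L f g) x)\<^sup>2))"

end

(* For fixed x, the functions t -> J(x,t) and t -> d/dx J(x,t) solve the same equation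
   k'' = - tau^2/P k in t, with data (0,-1) and (1,0) at t = x.  The energy P k'^2 + tau^2 k^2 has
   derivative P' k'^2, so Gronwall's inequality bounds |k'| by a constant, respectively by a constant
   times tau.  Writing tau^2 k = P' k' - (P k')' and integrating by parts against the absolutely
   continuous representative of f gains a factor tau^{-2}.  A vanishing Wronskian makes both kernels
   0 because x/0 = 0. *)
theory Submission
  imports Defs
begin

section \<open>Integration by parts for indefinite integrals\<close>

text \<open>In the energy P k'^2 + tau^2 k^2 the weights make the tau^2 terms cancel under
  differentiation, so the Gronwall exponent, and with it C, is free of tau. Used directly, the
  energy bounds the two kernels k only by multiples of 1/tau and of 1, which misses each estimate by
  one factor tau. After integration by parts the size of k' over tau^2 is what counts, so a single
  lemma with a bound for k' as parameter serves both estimates. The obstacle is f. Membership in H^1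
  only offers a weak derivative g tested against smooth functions, so the absolutely continuous
  representative has to be constructed: f minus a primitive of g is orthogonal to the derivative of
  every test function and is therefore constant almost everywhere (du Bois-Reymond). That argument
  requires explicit test functions, which come from exp(-c/((x-a)(b-x))) with c tending to 0.
  Integration by parts must likewise work for primitives of merely integrable functions.\<close>

lemma absolutely_integrable_mult_continuous:
  fixes g k :: "real \<Rightarrow> real"
  assumes "g absolutely_integrable_on {a..b}" "continuous_on {a..b} k"
  shows "(\<lambda>t. g t * k t) absolutely_integrable_on {a..b}"
proof -
  have "(\<lambda>t. k t * g t) absolutely_integrable_on {a..b}"
  proof (rule absolutely_integrable_bounded_measurable_product_real[OF _ _ _ assms(1)])
    show "k \<in> borel_measurable (lebesgue_on {a..b})"
      by (intro continuous_imp_measurable_on_sets_lebesgue assms) auto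
    show "bounded (k ` {a..b})"
      by (intro compact_imp_bounded compact_continuous_image assms) auto
  qed auto
  then show ?thesis by (simp add: mult.commute)
qed

lemma abs_integral_mult_le:
  fixes g k :: "real \<Rightarrow> real"
  assumes g: "g absolutely_integrable_on {a..b}" and k: "continuous_on {a..b} k"
    and B: "\<And>t. t \<in> {a..b} \<Longrightarrow> \<bar>k t\<bar> \<le> B"
  shows "\<bar>integral {a..b} (\<lambda>t. g t * k t)\<bar> \<le> integral {a..b} (\<lambda>t. \<bar>g t\<bar>) * B"
proof -
  have "norm (integral {a..b} (\<lambda>t. g t * k t)) \<le> integral {a..b} (\<lambda>t. \<bar>g t\<bar> * B)"
  proof (rule integral_norm_bound_integral)
    show "(\<lambda>t. g t * k t) integrable_on {a..b}"
      using absolutely_integrable_mult_continuous[OF g k] by (rule set_lebesgue_integral_eq_integral(1))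
    show "(\<lambda>t. \<bar>g t\<bar> * B) integrable_on {a..b}"
      using g by (intro integrable_on_mult_left) (auto simp: absolutely_integrable_on_def)
    show "norm (g t * k t) \<le> \<bar>g t\<bar> * B" if "t \<in> {a..b}" for t
      using B[OF that] by (simp add: abs_mult mult_left_mono)
  qed
  then show ?thesis by simp
qed

text \<open>The difference \<open>\<Phi>\<close> of the two sides, as a function of the upper end point, has increments
  bounded by a multiple of \<open>(y - x) * (A y - A x)\<close> with \<open>A\<close> continuous, hence \<open>\<Phi>' = 0\<close>.\<close>
lemma integral_by_parts_primitive:
  fixes g h h' :: "real \<Rightarrow> real"
  assumes ab: "a \<le> b" and g: "g absolutely_integrable_on {a..b}"
    and h: "\<And>x. x \<in> {a..b} \<Longrightarrow> (h has_real_derivative h' x) (at x within {a..b})"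
    and h': "continuous_on {a..b} h'"
  shows "integral {a..b} (\<lambda>t. integral {a..t} g * h' t)
       = integral {a..b} g * h b - integral {a..b} (\<lambda>t. g t * h t)"
proof -
  define G where "G x = integral {a..x} g" for x
  define A where "A x = integral {a..x} (\<lambda>t. \<bar>g t\<bar>)" for x
  define \<Phi> where "\<Phi> x = G x * h x - integral {a..x} (\<lambda>t. g t * h t) - integral {a..x} (\<lambda>t. G t * h' t)" for x
  have ch: "continuous_on {a..b} h"
    using h by (meson DERIV_continuous continuous_on_eq_continuous_within)
  have gi: "g integrable_on {a..b}" and agi: "(\<lambda>t. \<bar>g t\<bar>) integrable_on {a..b}"
    using g by (auto simp: absolutely_integrable_on_def)
  have ghi: "(\<lambda>t. g t * h t) integrable_on {a..b}"
    using absolutely_integrable_mult_continuous[OF g ch] by (rule set_lebesgue_integral_eq_integral(1))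
  have cG: "continuous_on {a..b} G" and cA: "continuous_on {a..b} A"
    unfolding G_def A_def using gi agi by (auto intro: indefinite_integral_continuous_1)
  have Ghi: "(\<lambda>t. G t * h' t) integrable_on {a..b}"
    by (intro integrable_continuous_real continuous_intros cG h')
  have "bounded (h' ` {a..b})"
    by (intro compact_imp_bounded compact_continuous_image h' compact_Icc)
  then obtain H where "0 < H" and H: "\<And>t. t \<in> {a..b} \<Longrightarrow> \<bar>h' t\<bar> \<le> H"
    unfolding bounded_pos by auto
  then have H0: "0 \<le> H" by simp
  have comb: "integral {a..y} f - integral {a..x} f = integral {x..y} f"
    if "f integrable_on {a..b}" "a \<le> x" "x \<le> y" "y \<le> b" for f :: "real \<Rightarrow> real" and x y
    using Henstock_Kurzweil_Integration.integral_combine[of a x y f] that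
      integrable_on_subinterval[OF that(1), of a y] by auto
  have ineq: "\<bar>\<Phi> y - \<Phi> x\<bar> \<le> 2 * H * ((y - x) * (A y - A x))"
    if xy: "a \<le> x" "x \<le> y" "y \<le> b" for x y
  proof -
    have sub: "{x..y} \<subseteq> {a..b}" using xy by auto
    have gs: "g absolutely_integrable_on {x..y}"
      using absolutely_integrable_on_subinterval[OF g sub] .
    have gis: "g integrable_on {x..y}" and ghs: "(\<lambda>t. g t * h t) integrable_on {x..y}"
      and Ghs: "(\<lambda>t. G t * h' t) integrable_on {x..y}"
      using integrable_on_subinterval[OF _ sub] gi ghi Ghi by auto
    have h'i: "h' integrable_on {x..y}"
      by (intro integrable_continuous_real continuous_on_subset[OF h' sub])
    have ftc: "(h' has_integral (h y - h x)) {x..y}"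
    proof (rule fundamental_theorem_of_calculus[OF xy(2)])
      show "(h has_vector_derivative h' t) (at t within {x..y})" if "t \<in> {x..y}" for t
        using DERIV_subset[OF h sub] that sub
        by (auto simp: has_real_derivative_iff_has_vector_derivative)
    qed
    have e1: "integral {x..y} (\<lambda>t. g t * (h y - h t))
        = (G y - G x) * h y - integral {x..y} (\<lambda>t. g t * h t)"
      unfolding right_diff_distrib G_def
      by (subst integral_diff) (use gis ghs comb[OF gi xy] in \<open>auto intro!: integrable_on_mult_left\<close>)
    have e2: "integral {x..y} (\<lambda>t. (G t - G x) * h' t)
        = integral {x..y} (\<lambda>t. G t * h' t) - G x * (h y - h x)"
      unfolding left_diff_distrib
      using Ghs h'i integral_unique[OF ftc]
      by (subst integral_diff) (auto intro: integrable_on_mult_right)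
    \<comment> \<open>The increment of the product is split as
      \<open>(G y - G x) * h y + G x * (h y - h x)\<close>. Each part absorbs one of the two
      integrals, and each remaining integrand carries a difference that is small on
      \<open>{x..y}\<close>.\<close>
    have eq: "\<Phi> y - \<Phi> x = integral {x..y} (\<lambda>t. g t * (h y - h t))
         - integral {x..y} (\<lambda>t. (G t - G x) * h' t)"
      unfolding e1 e2 \<Phi>_def using comb[OF ghi xy] comb[OF Ghi xy] by (simp add: algebra_simps)
    have b1: "\<bar>integral {x..y} (\<lambda>t. g t * (h y - h t))\<bar> \<le> integral {x..y} (\<lambda>t. \<bar>g t\<bar>) * (H * (y - x))"
    proof (rule abs_integral_mult_le[OF gs])
      show "continuous_on {x..y} (\<lambda>t. h y - h t)"
        by (intro continuous_intros continuous_on_subset[OF ch sub])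
      show "\<bar>h y - h t\<bar> \<le> H * (y - x)" if t: "t \<in> {x..y}" for t
      proof -
        have "norm (h y - h t) \<le> H * norm (y - t)"
          using t xy H by (intro field_differentiable_bound[where S = "{a..b}" and f' = h'] h) auto
        also have "\<dots> \<le> H * (y - x)" using t H0 by (auto intro!: mult_left_mono)
        finally show ?thesis by simp
      qed
    qed
    have b2: "\<bar>integral {x..y} (\<lambda>t. (G t - G x) * h' t)\<bar> \<le> (A y - A x) * H * (y - x)"
    proof -
      have "norm (integral (cbox x y) (\<lambda>t. (G t - G x) * h' t)) \<le> (A y - A x) * H * measure lborel (cbox x y)"
      proof (rule integrable_bound)
        show "(\<lambda>t. (G t - G x) * h' t) integrable_on cbox x y"
          unfolding box_real
          by (intro integrable_continuous_real continuous_intros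
              continuous_on_subset[OF cG sub] continuous_on_subset[OF h' sub])
        have mono: "A t \<le> A y" if "t \<in> {x..y}" for t
          using comb[OF agi, of t y] that xy
            integral_nonneg[OF integrable_on_subinterval[OF agi, of t y]] by (auto simp: A_def)
        have "A x \<le> A y" using mono[of x] xy by auto
        then show "0 \<le> (A y - A x) * H" using H0 by simp
        show "norm ((G t - G x) * h' t) \<le> (A y - A x) * H" if "t \<in> cbox x y" for t
        proof -
          have t: "t \<in> {x..y}" using that by simp
          have "\<bar>G t - G x\<bar> = norm (integral {x..t} g)"
            unfolding G_def using comb[OF gi, of x t] t xy by simp
          also have "\<dots> \<le> integral {x..t} (\<lambda>t. \<bar>g t\<bar>)"
            using t xy by (intro integral_norm_bound_integral integrable_on_subinterval[OF gi]
                integrable_on_subinterval[OF agi]) auto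
          also have "\<dots> = A t - A x"
            unfolding A_def using comb[OF agi, of x t] t xy by simp
          also have "\<dots> \<le> A y - A x" using mono[OF t] by simp
          finally have "\<bar>G t - G x\<bar> \<le> A y - A x" .
          then show ?thesis using H[of t] t sub by (auto simp: abs_mult intro!: mult_mono)
        qed
      qed
      then show ?thesis using xy by simp
    qed
    have "integral {x..y} (\<lambda>t. \<bar>g t\<bar>) = A y - A x"
      unfolding A_def using comb[OF agi xy] by simp
    then have "\<bar>integral {x..y} (\<lambda>t. g t * (h y - h t))\<bar> \<le> H * ((y - x) * (A y - A x))"
      using b1 by (simp add: mult_ac)
    moreover have "\<bar>integral {x..y} (\<lambda>t. (G t - G x) * h' t)\<bar> \<le> H * ((y - x) * (A y - A x))"
      using b2 by (simp add: mult_ac)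
    ultimately show ?thesis unfolding eq by linarith
  qed
  have "\<exists>c. \<forall>x\<in>{a..b}. \<Phi> x = c"
  proof (rule has_field_derivative_zero_constant)
    fix x assume x: "x \<in> {a..b}"
    have bnd: "\<bar>(\<Phi> y - \<Phi> x) / (y - x)\<bar> \<le> 2 * H * \<bar>A y - A x\<bar>" if "y \<in> {a..b}" "y \<noteq> x" for y
    proof -
      have "\<bar>\<Phi> y - \<Phi> x\<bar> \<le> 2 * H * \<bar>A y - A x\<bar> * \<bar>y - x\<bar>"
      proof (cases "x \<le> y")
        case True
        have "\<bar>\<Phi> y - \<Phi> x\<bar> \<le> 2 * H * ((y - x) * (A y - A x))" using ineq that True x by auto
        also have "\<dots> \<le> 2 * H * ((y - x) * \<bar>A y - A x\<bar>)"
          using H0 True by (intro mult_left_mono) auto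
        finally show ?thesis using True by (simp add: mult_ac)
      next
        case False
        have "\<bar>\<Phi> x - \<Phi> y\<bar> \<le> 2 * H * ((x - y) * (A x - A y))" using ineq that False x by auto
        also have "\<dots> \<le> 2 * H * ((x - y) * \<bar>A x - A y\<bar>)"
          using H0 False by (intro mult_left_mono) auto
        finally show ?thesis using False by (simp add: mult_ac abs_minus_commute)
      qed
      then show ?thesis using that by (simp add: divide_simps)
    qed
    have "((\<lambda>y. (\<Phi> y - \<Phi> x) / (y - x)) \<longlongrightarrow> 0) (at x within {a..b})"
    proof (rule Lim_null_comparison)
      show "\<forall>\<^sub>F y in at x within {a..b}. norm ((\<Phi> y - \<Phi> x) / (y - x)) \<le> 2 * H * \<bar>A y - A x\<bar>"
        using bnd by (auto simp: eventually_at_filter simp del: abs_divide)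
      have "(A \<longlongrightarrow> A x) (at x within {a..b})"
        using cA x by (auto simp: continuous_on_def)
      then show "((\<lambda>y. 2 * H * \<bar>A y - A x\<bar>) \<longlongrightarrow> 0) (at x within {a..b})"
        by (auto intro!: tendsto_eq_intros)
    qed
    then show "(\<Phi> has_field_derivative 0) (at x within {a..b})"
      by (simp add: has_field_derivative_iff)
  qed auto
  then have "\<Phi> b = \<Phi> a" using ab by auto
  then show ?thesis unfolding \<Phi>_def G_def by simp
qed

text \<open>Henstock's lemma makes the sum of |f(x)|k| - integral of f over k| small over every fine
  tagged division. Here all those integrals vanish, so the sum is a Riemann sum of |f|. This plays
  the part of Lebesgue's differentiation theorem.\<close>

lemma has_integral_abs_0_if_integral_0:
  fixes f :: "real \<Rightarrow> real"
  assumes f: "f integrable_on {a..b}"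
    and zero: "\<And>c d. c \<le> d \<Longrightarrow> {c..d} \<subseteq> {a..b} \<Longrightarrow> integral {c..d} f = 0"
  shows "((\<lambda>x. \<bar>f x\<bar>) has_integral 0) {a..b}"
  unfolding has_integral[of _ _ a b, unfolded box_real]
proof (intro allI impI)
  fix e :: real assume "0 < e"
  obtain \<gamma> where \<gamma>: "gauge \<gamma>"
    and p: "\<And>p. \<lbrakk>p tagged_partial_division_of (cbox a b); \<gamma> fine p\<rbrakk> \<Longrightarrow>
             sum (\<lambda>(x,k). norm(measure lborel k *\<^sub>R f x - integral k f)) p < e"
    by (rule Henstock_lemma[of f a b e]) (use f \<open>0 < e\<close> in auto)
  show "\<exists>\<gamma>. gauge \<gamma> \<and> (\<forall>\<D>. \<D> tagged_division_of {a..b} \<and> \<gamma> fine \<D> \<longrightarrow>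
     norm ((\<Sum>(x, k)\<in>\<D>. measure lborel k *\<^sub>R \<bar>f x\<bar>) - 0) < e)"
  proof (intro exI[of _ \<gamma>] conjI \<gamma> allI impI)
    fix D assume D: "D tagged_division_of {a..b} \<and> \<gamma> fine D"
    then have td: "D tagged_division_of cbox a b" by simp
    have "(\<Sum>(x, k)\<in>D. measure lborel k *\<^sub>R \<bar>f x\<bar>) = (\<Sum>(x,k)\<in>D. norm(measure lborel k *\<^sub>R f x - integral k f))"
    proof (rule sum.cong[OF refl], safe)
      fix x k assume xk: "(x, k) \<in> D"
      obtain c d where k: "k = cbox c d" using tagged_division_ofD(4)[OF td xk] by blast
      have "c \<le> d" using tagged_division_ofD(2)[OF td xk] k by auto
      moreover have "k \<subseteq> {a..b}" using tagged_division_ofD(3)[OF td xk] by simp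
      ultimately have "integral k f = 0" using zero[of c d] k by simp
      then show "measure lborel k *\<^sub>R \<bar>f x\<bar> = norm (measure lborel k *\<^sub>R f x - integral k f)"
        by (simp add: abs_mult)
    qed
    also have "\<dots> < e" by (rule p) (use D td in \<open>auto simp: tagged_division_of_def\<close>)
    finally show "norm ((\<Sum>(x, k)\<in>D. measure lborel k *\<^sub>R \<bar>f x\<bar>) - 0) < e"
      by (simp add: abs_of_nonneg sum_nonneg split_beta)
  qed
qed

section \<open>Smooth bump functions\<close>

text \<open>The polynomial \<open>p\<close> and the exponent \<open>k\<close> are there to make the class closed under differentiation.\<close>
definition bump :: "real \<Rightarrow> real \<Rightarrow> real \<Rightarrow> real poly \<Rightarrow> nat \<Rightarrow> real \<Rightarrow> real" where
  "bump a b c p k x =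
     (if a < x \<and> x < b then poly p x / ((x - a) * (b - x)) ^ k * exp (- (c / ((x - a) * (b - x)))) else 0)"

text \<open>This is exp u \<ge> (1 + u/n)^n \<ge> (u/n)^n at u = c/w, inverted. It lets the
  exponential beat a pole of any order in \<open>w\<close>.\<close>

lemma exp_minus_inverse_le:
  fixes w c :: real
  assumes "w > 0" "c > 0" "n > 0"
  shows "exp (- (c / w)) \<le> (real n / c) ^ n * w ^ n"
proof -
  have u: "c / w > 0" using assms by simp
  have "(c / w / real n) ^ n \<le> (1 + c / w / real n) ^ n"
    using u assms by (intro power_mono) auto
  also have "\<dots> \<le> exp (c / w)"
    using u assms by (intro exp_ge_one_plus_x_over_n_power_n) (auto intro: order_trans[of _ 0])
  finally have "inverse (exp (c / w)) \<le> inverse ((c / w / real n) ^ n)"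
    using u assms by (intro le_imp_inverse_le) auto
  also have "\<dots> = (real n / c) ^ n * w ^ n"
    using assms by (simp add: field_simps)
  finally show ?thesis by (simp add: exp_minus)
qed

text \<open>Of the power \<open>w ^ (k + 2)\<close> gained from the exponential, \<open>k\<close>
  factors cancel the pole and two remain. The resulting quadratic vanishing at both end points
  yields the derivative 0 there.\<close>

lemma bump_le_square:
  assumes "a < b" "c > 0"
  obtains M where "0 \<le> M" "\<And>x. \<bar>bump a b c p k x\<bar> \<le> M * (x - a)\<^sup>2" "\<And>x. \<bar>bump a b c p k x\<bar> \<le> M * (x - b)\<^sup>2"
proof -
  have "bounded (poly p ` {a..b})"
    by (intro compact_imp_bounded compact_continuous_image compact_Icc continuous_intros)
  then obtain Q where "0 < Q" and Q: "\<And>t. t \<in> {a..b} \<Longrightarrow> \<bar>poly p t\<bar> \<le> Q"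
    unfolding bounded_pos by auto
  define C where "C = Q * (real (k + 2) / c) ^ (k + 2)"
  have C0: "0 \<le> C" unfolding C_def using \<open>0 < Q\<close> assms by simp
  have key: "\<bar>bump a b c p k x\<bar> \<le> C * ((x - a)\<^sup>2 * (b - x)\<^sup>2)" if x: "a < x" "x < b" for x
  proof -
    define w where "w = (x - a) * (b - x)"
    have w: "w > 0" unfolding w_def using x by simp
    have "\<bar>bump a b c p k x\<bar> = \<bar>poly p x\<bar> * (exp (- (c / w)) / w ^ k)"
      unfolding bump_def w_def[symmetric] using x w by (simp add: abs_mult abs_divide)
    also have "\<dots> \<le> Q * (((real (k + 2) / c) ^ (k + 2) * w ^ (k + 2)) / w ^ k)"
      using Q[of x] x w \<open>0 < Q\<close> exp_minus_inverse_le[OF w assms(2), of "k + 2"]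
      by (intro mult_mono divide_right_mono) auto
    also have "\<dots> = C * w\<^sup>2" using w by (simp add: C_def power_add) (simp add: power2_eq_square)
    finally show ?thesis by (simp add: w_def power_mult_distrib)
  qed
  show thesis
  proof (rule that[of "C * (b - a)\<^sup>2"])
    show "0 \<le> C * (b - a)\<^sup>2" using C0 by simp
    show "\<bar>bump a b c p k x\<bar> \<le> C * (b - a)\<^sup>2 * (x - a)\<^sup>2" for x
    proof (cases "a < x \<and> x < b")
      case True
      have "\<bar>bump a b c p k x\<bar> \<le> C * ((x - a)\<^sup>2 * (b - x)\<^sup>2)" using key True by blast
      also have "\<dots> \<le> C * ((x - a)\<^sup>2 * (b - a)\<^sup>2)"
        using True C0 by (intro mult_left_mono power_mono) auto
      finally show ?thesis by (simp add: mult_ac)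
    qed (use C0 in \<open>auto simp: bump_def\<close>)
    show "\<bar>bump a b c p k x\<bar> \<le> C * (b - a)\<^sup>2 * (x - b)\<^sup>2" for x
    proof (cases "a < x \<and> x < b")
      case True
      have "\<bar>bump a b c p k x\<bar> \<le> C * ((x - a)\<^sup>2 * (b - x)\<^sup>2)" using key True by blast
      also have "\<dots> \<le> C * ((b - a)\<^sup>2 * (b - x)\<^sup>2)"
        using True C0 by (intro mult_left_mono mult_right_mono power_mono) auto
      finally show ?thesis by (simp add: mult_ac power2_commute)
    qed (use C0 in \<open>auto simp: bump_def\<close>)
  qed
qed

lemma DERIV_zero_if_le_square:
  fixes f :: "real \<Rightarrow> real"
  assumes "\<And>x. \<bar>f x\<bar> \<le> M * (x - e)\<^sup>2"
  shows "(f has_real_derivative 0) (at e)"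
proof -
  have fe: "f e = 0" using assms[of e] by simp
  have "((\<lambda>y. (f y - f e) / (y - e)) \<longlongrightarrow> 0) (at e)"
  proof (rule Lim_null_comparison)
    have "norm ((f y - f e) / (y - e)) \<le> M * \<bar>y - e\<bar>" if "y \<noteq> e" for y
      using assms[of y] that fe
      by (simp add: divide_simps power2_eq_square abs_mult[symmetric] mult.assoc)
    then show "\<forall>\<^sub>F y in at e. norm ((f y - f e) / (y - e)) \<le> M * \<bar>y - e\<bar>"
      by (auto simp: eventually_at_filter)
    show "((\<lambda>y. M * \<bar>y - e\<bar>) \<longlongrightarrow> 0) (at e)"
      by (auto intro!: tendsto_eq_intros)
  qed
  then show ?thesis by (simp add: has_field_derivative_iff)
qed

lemma bump_has_derivative_bump:
  assumes ab: "a < b" and c: "c > 0"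
  obtains q where "\<And>x. (bump a b c p k has_real_derivative bump a b c q (k + 2) x) (at x)"
proof -
  define w where "w = [:-a, 1:] * [:b, -1:]"
  \<comment> \<open>For the product p * w^(-k) * exp(-c/w) this is the numerator of the derivative
    over the common denominator w^(k+2). The three terms stem from p, from w^(-k) and from the
    exponential.\<close>
  define q where "q = pderiv p * w\<^sup>2 - of_nat k * p * pderiv w * w + smult c (p * pderiv w)"
  have pw: "poly w x = (x - a) * (b - x)" for x by (simp add: w_def algebra_simps)
  obtain M where "0 \<le> M" and M: "\<And>x. \<bar>bump a b c p k x\<bar> \<le> M * (x - a)\<^sup>2"
      "\<And>x. \<bar>bump a b c p k x\<bar> \<le> M * (x - b)\<^sup>2"
    by (rule bump_le_square[OF ab c, where p = p and k = k]) blast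
  have "(bump a b c p k has_real_derivative bump a b c q (k + 2) x) (at x)" for x
  proof -
    consider "a < x \<and> x < b" | "x < a" | "b < x" | "x = a" | "x = b" by linarith
    then show ?thesis
    proof cases
      case 1
      then have w0: "poly w x > 0" by (simp add: pw)
      \<comment> \<open>The power rule produces the truncated exponent \<open>k - Suc 0\<close>; for
        \<open>k = 0\<close> the factor \<open>real k\<close> makes both sides 0.\<close>
      have kk: "real k * poly w x ^ (k - Suc 0) = real k * poly w x ^ k / poly w x"
        using w0 by (cases k) auto
      have "((\<lambda>x. poly p x / poly w x ^ k * exp (- (c / poly w x))) has_real_derivative
         (poly (pderiv p) x / poly w x ^ k - real k * poly p x * poly (pderiv w) x / (poly w x ^ k * poly w x)
           + poly p x / poly w x ^ k * c * poly (pderiv w) x / (poly w x)\<^sup>2) * exp (- (c / poly w x))) (at x)"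
        using w0
        by (auto intro!: derivative_eq_intros poly_DERIV simp: kk power2_eq_square)
           (simp add: field_simps, cases k; simp)
      also have "(poly (pderiv p) x / poly w x ^ k - real k * poly p x * poly (pderiv w) x / (poly w x ^ k * poly w x)
           + poly p x / poly w x ^ k * c * poly (pderiv w) x / (poly w x)\<^sup>2) * exp (- (c / poly w x))
         = bump a b c q (k + 2) x"
      proof -
        have "(A / B - C / (B * W) + D / B * F * G / W\<^sup>2) = (A * W\<^sup>2 - C * W + F * (D * G)) / (B * W\<^sup>2)"
          if "W \<noteq> 0" "B \<noteq> 0" for A B C D F G W :: real
          using that by (simp add: field_simps power2_eq_square)
        from this[of "poly w x" "poly w x ^ k"] show ?thesis
          unfolding bump_def pw[symmetric] using 1 w0
          by (simp add: q_def power_add) (simp add: power2_eq_square)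
      qed
      finally show ?thesis
        by (rule has_field_derivative_transform_within_open[of _ _ _ "{a<..<b}"])
           (use 1 in \<open>auto simp: bump_def pw\<close>)
    next
      case 2
      then have z: "bump a b c q (k + 2) x = 0" by (simp add: bump_def)
      show ?thesis
        unfolding z
        by (rule has_field_derivative_transform_within_open[of "\<lambda>_. 0" _ _ "{..<a}"])
           (use 2 in \<open>auto simp: bump_def\<close>)
    next
      case 3
      then have z: "bump a b c q (k + 2) x = 0" by (simp add: bump_def)
      show ?thesis
        unfolding z
        by (rule has_field_derivative_transform_within_open[of "\<lambda>_. 0" _ _ "{b<..}"])
           (use 3 in \<open>auto simp: bump_def\<close>)
    next
      case 4
      then have "bump a b c q (k + 2) x = 0" by (simp add: bump_def)
      then show ?thesis using DERIV_zero_if_le_square[OF M(1)] 4 by simp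
    next
      case 5
      then have "bump a b c q (k + 2) x = 0" by (simp add: bump_def)
      then show ?thesis using DERIV_zero_if_le_square[OF M(2)] 5 by simp
    qed
  qed
  then show thesis using that by blast
qed

text \<open>Two summands on different intervals are carried along because the test functions used
  later have a combination of two bumps as derivative. The induction closes since differentiation
  only changes the polynomials and raises the exponents by 2.\<close>

lemma deriv_funpow_bump_sum:
  assumes "a < b" "c > 0" "a' < b'" "c' > 0"
  shows "\<exists>p q k l. (deriv ^^ n) (\<lambda>x. bump a b c p0 k0 x + bump a' b' c' q0 l0 x)
      = (\<lambda>x. bump a b c p k x + bump a' b' c' q l x)"
proof (induction n)
  case 0
  show ?case by auto
next
  case (Suc n)
  then obtain p q k l where IH: "(deriv ^^ n) (\<lambda>x. bump a b c p0 k0 x + bump a' b' c' q0 l0 x)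
      = (\<lambda>x. bump a b c p k x + bump a' b' c' q l x)" by blast
  obtain p' where p': "\<And>x. (bump a b c p k has_real_derivative bump a b c p' (k + 2) x) (at x)"
    by (rule bump_has_derivative_bump[OF assms(1,2), where p = p and k = k]) blast
  obtain q' where q': "\<And>x. (bump a' b' c' q l has_real_derivative bump a' b' c' q' (l + 2) x) (at x)"
    by (rule bump_has_derivative_bump[OF assms(3,4), where p = q and k = l]) blast
  have "(deriv ^^ Suc n) (\<lambda>x. bump a b c p0 k0 x + bump a' b' c' q0 l0 x)
      = (\<lambda>x. bump a b c p' (k + 2) x + bump a' b' c' q' (l + 2) x)"
    using DERIV_imp_deriv[OF DERIV_add[OF p' q']] by (auto simp: IH)
  then show ?case by blast
qed

lemma deriv_funpow_bump_sum_differentiable: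
  assumes "a < b" "c > 0" "a' < b'" "c' > 0"
  shows "(deriv ^^ n) (\<lambda>x. bump a b c p k x + bump a' b' c' q l x) differentiable (at x)"
proof -
  obtain p1 q1 k1 l1 where eq: "(deriv ^^ n) (\<lambda>x. bump a b c p k x + bump a' b' c' q l x)
      = (\<lambda>x. bump a b c p1 k1 x + bump a' b' c' q1 l1 x)"
    using deriv_funpow_bump_sum[OF assms] by blast
  obtain p' where p': "\<And>x. (bump a b c p1 k1 has_real_derivative bump a b c p' (k1 + 2) x) (at x)"
    by (rule bump_has_derivative_bump[OF assms(1,2), where p = p1 and k = k1]) blast
  obtain q' where q': "\<And>x. (bump a' b' c' q1 l1 has_real_derivative bump a' b' c' q' (l1 + 2) x) (at x)"
    by (rule bump_has_derivative_bump[OF assms(3,4), where p = q1 and k = l1]) blast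
  show ?thesis
    unfolding eq real_differentiable_def using DERIV_add[OF p' q'] by (rule exI)
qed

lemma continuous_on_bump:
  assumes "a < b" "c > 0"
  shows "continuous_on S (bump a b c p k)"
proof -
  obtain q where q: "\<And>x. (bump a b c p k has_real_derivative bump a b c q (k + 2) x) (at x)"
    by (rule bump_has_derivative_bump[OF assms, where p = p and k = k]) blast
  have "continuous_on UNIV (bump a b c p k)"
    using DERIV_isCont[OF q] by (intro continuous_at_imp_continuous_on) blast
  then show ?thesis by (rule continuous_on_subset) simp
qed

lemma test_fun_primitive:
  assumes \<psi>: "\<And>x. (\<psi> has_real_derivative \<eta> x) (at x)"
    and smooth: "\<And>n x. (deriv ^^ n) \<eta> differentiable (at x)"
    and supp: "{x. \<psi> x \<noteq> 0} \<subseteq> {a..b}" and "0 < a" "b < L"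
  shows "test_fun L \<psi>"
proof -
  have d: "deriv \<psi> = \<eta>" using DERIV_imp_deriv[OF \<psi>] by auto
  have "(deriv ^^ n) \<psi> differentiable (at x)" for n x
  proof (cases n)
    case 0
    then show ?thesis using \<psi> real_differentiable_def by auto
  next
    case (Suc m)
    then show ?thesis using smooth[of m x] by (simp add: funpow_Suc_right d del: funpow.simps)
  qed
  moreover have "closure {x. \<psi> x \<noteq> 0} \<subseteq> {a..b}"
    by (intro closure_minimal supp) simp
  moreover from this have "compact (closure {x. \<psi> x \<noteq> 0})"
    using bounded_subset[OF bounded_closed_interval] by (auto simp: compact_eq_bounded_closed)
  ultimately show ?thesis unfolding test_fun_def using assms(4,5) by (auto simp: subset_iff)
qed

section \<open>The absolutely continuous representative of an H1 function\<close>

text \<open>Letting the parameter c tend to 0 makes exp(-c/w) converge to 1 inside the interval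
  while it stays between 0 and 1. The smooth bumps thus approximate an indicator function, and
  dominated convergence applies with majorant |r|.\<close>

lemma integral_mult_bump_tendsto:
  assumes r: "r absolutely_integrable_on {0..L}" and ab: "0 < a" "a < b" "b < L"
  shows "(\<lambda>n. integral {0..L} (\<lambda>x. r x * bump a b (1 / real (Suc n)) 1 0 x)) \<longlonglongrightarrow> integral {a..b} r"
proof -
  have "(\<lambda>n. integral {0..L} (\<lambda>x. r x * bump a b (1 / real (Suc n)) 1 0 x))
      \<longlonglongrightarrow> integral {0..L} (\<lambda>x. if x \<in> {a<..<b} then r x else 0)"
  proof (rule dominated_convergence(2))
    show "(\<lambda>x. r x * bump a b (1 / real (Suc n)) 1 0 x) integrable_on {0..L}" for n
      using absolutely_integrable_mult_continuous[OF r continuous_on_bump[OF ab(2)]]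
      by (intro set_lebesgue_integral_eq_integral(1)) auto
    show "(\<lambda>x. \<bar>r x\<bar>) integrable_on {0..L}"
      using r by (auto simp: absolutely_integrable_on_def)
    show "norm (r x * bump a b (1 / real (Suc n)) 1 0 x) \<le> \<bar>r x\<bar>" for n x
    proof -
      have "\<bar>bump a b (1 / real (Suc n)) 1 0 x\<bar> \<le> 1"
        by (auto simp: bump_def intro!: mult_nonneg_nonneg)
      then show ?thesis by (simp add: abs_mult mult_left_le)
    qed
    show "(\<lambda>n. r x * bump a b (1 / real (Suc n)) 1 0 x) \<longlonglongrightarrow> (if x \<in> {a<..<b} then r x else 0)" for x
    proof (cases "x \<in> {a<..<b}")
      case True
      have "(\<lambda>n. 1 / real (Suc n)) \<longlonglongrightarrow> 0"
        using LIMSEQ_inverse_real_of_nat by (simp add: inverse_eq_divide)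
      then have "(\<lambda>n. r x * exp (- (1 / real (Suc n) / ((x - a) * (b - x))))) \<longlonglongrightarrow> r x * exp (- (0 / ((x - a) * (b - x))))"
        using True by (intro tendsto_intros) auto
      moreover have "bump a b (1 / real (Suc n)) 1 0 x = exp (- (1 / real (Suc n) / ((x - a) * (b - x))))" for n
        using True by (simp add: bump_def)
      ultimately show ?thesis using True by simp
    qed (auto simp: bump_def)
  qed
  also have "integral {0..L} (\<lambda>x. if x \<in> {a<..<b} then r x else 0) = integral {a<..<b} r"
    unfolding integral_restrict_Int using ab by (intro arg_cong2[where f = integral]) auto
  also have "\<dots> = integral {a..b} r"
    by (rule integral_open_interval_real[symmetric])
  finally show ?thesis .
qed

text \<open>A smooth function supported inside (0,L) is the derivative of a test function once its
  integral vanishes. Weighting each bump by the integral of the other one achieves this.\<close>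

lemma test_fun_difference_of_bumps:
  assumes ab: "0 < a" "a < b" "b < L" and ab': "0 < a'" "a' < b'" "b' < L" and c: "c > 0"
  defines "K \<equiv> bump a b c 1 0" and "K' \<equiv> bump a' b' c 1 0"
  obtains \<psi> where "test_fun L \<psi>"
    "deriv \<psi> = (\<lambda>x. integral {0..L} K' * K x - integral {0..L} K * K' x)"
proof -
  define m m' where "m = integral {0..L} K" and "m' = integral {0..L} K'"
  \<comment> \<open>The weights are stored as constant polynomials, so that \<open>\<eta>\<close> is
    literally a sum of two bumps and its higher derivatives are covered by the results on such
    sums.\<close>
  define \<eta> where "\<eta> = (\<lambda>x. bump a b c [:m':] 0 x + bump a' b' c [:-m:] 0 x)"
  have \<eta>: "\<eta> x = m' * K x - m * K' x" for x
    by (simp add: \<eta>_def K_def K'_def bump_def)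
  have cont: "continuous_on S \<eta>" for S
    unfolding \<eta>_def by (intro continuous_intros continuous_on_bump ab ab' c)
  have KI: "K integrable_on {0..L}" "K' integrable_on {0..L}"
    unfolding K_def K'_def by (intro integrable_continuous_real continuous_on_bump ab ab' c)+
  have tot: "integral {0..L} \<eta> = 0"
  proof -
    have "integral {0..L} \<eta> = integral {0..L} (\<lambda>x. m' * K x) - integral {0..L} (\<lambda>x. m * K' x)"
      unfolding \<eta> by (intro integral_diff integrable_on_mult_right KI)
    then show ?thesis by (simp add: m_def m'_def)
  qed
  \<comment> \<open>An antiderivative on the whole line is taken because \<open>test_fun\<close>
    demands derivatives at every real point, not only on \<open>{0..L}\<close>.\<close>
  have "\<exists>F. \<forall>x. - \<infinity> < ereal x \<longrightarrow> ereal x < \<infinity> \<longrightarrow> (F has_vector_derivative \<eta> x) (at x)"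
    by (rule einterval_antiderivative)
       (use cont[of UNIV] in \<open>auto simp: continuous_on_eq_continuous_at\<close>)
  then obtain F where F: "\<And>x. (F has_real_derivative \<eta> x) (at x)"
    by (auto simp: has_real_derivative_iff_has_vector_derivative)
  define \<psi> where "\<psi> x = F x - F 0" for x
  have \<psi>: "(\<psi> has_real_derivative \<eta> x) (at x)" for x
    unfolding \<psi>_def by (auto intro!: derivative_eq_intros F)
  have const: "\<psi> x = \<psi> y" if "convex S" "\<And>x. x \<in> S \<Longrightarrow> \<eta> x = 0" "x \<in> S" "y \<in> S" for S x y
  proof -
    have "\<exists>c. \<forall>x\<in>S. \<psi> x = c"
    proof (rule has_field_derivative_zero_constant[OF that(1)])
      show "(\<psi> has_field_derivative 0) (at z within S)" if "z \<in> S" for z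
        using DERIV_subset[OF \<psi>[of z] subset_UNIV] \<open>\<And>x. x \<in> S \<Longrightarrow> \<eta> x = 0\<close>[OF that] by simp
    qed
    then show ?thesis using that by auto
  qed
  have L0: "0 < L" using ab by simp
  have "(\<eta> has_integral (\<psi> L - \<psi> 0)) {0..L}"
    using L0 DERIV_subset[OF \<psi>]
    by (intro fundamental_theorem_of_calculus)
       (auto simp: has_real_derivative_iff_has_vector_derivative[symmetric])
  then have "\<psi> L = \<psi> 0" using tot by (simp add: integral_unique)
  then have \<psi>0: "\<psi> 0 = 0" "\<psi> L = 0" by (auto simp: \<psi>_def)
  \<comment> \<open>Off the hull of the two intervals \<open>\<eta>\<close> vanishes and
    \<open>\<psi>\<close> is constant. The constant is \<open>\<psi> 0 = 0\<close> on the left and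
    \<open>\<psi> L\<close> on the right, which is 0 because the total integral of
    \<open>\<eta>\<close> is 0.\<close>
  have left: "\<psi> x = 0" if "x < min a a'" for x
    using const[of "{..min a a'}" x 0] \<psi>0 that ab ab' by (auto simp: \<eta>_def bump_def)
  have right: "\<psi> x = 0" if "x > max b b'" for x
    using const[of "{max b b'..}" x L] \<psi>0 that ab ab' by (auto simp: \<eta>_def bump_def)
  have "test_fun L \<psi>"
  proof (rule test_fun_primitive[OF \<psi>])
    show "(deriv ^^ n) \<eta> differentiable (at x)" for n x
      unfolding \<eta>_def by (intro deriv_funpow_bump_sum_differentiable ab ab' c)
    show "{x. \<psi> x \<noteq> 0} \<subseteq> {min a a'..max b b'}"
      using left right by (force simp: not_le[symmetric])
  qed (use ab ab' in auto)
  moreover have "deriv \<psi> = (\<lambda>x. m' * K x - m * K' x)"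
    using DERIV_imp_deriv[OF \<psi>] \<eta> by auto
  ultimately show thesis using that unfolding m_def m'_def by blast
qed

text \<open>Testing with two bumps and letting them tend to indicators shows that \<open>r\<close>
  has the same mean over all compact intervals inside (0,L). Subtracting this mean leaves a function
  with integral 0 over every interval.\<close>

lemma du_Bois_Reymond:
  assumes L: "0 < L" and r: "r absolutely_integrable_on {0..L}"
    and orth: "\<And>\<psi>. test_fun L \<psi> \<Longrightarrow> integral {0..L} (\<lambda>x. r x * deriv \<psi> x) = 0"
  obtains c where "((\<lambda>x. \<bar>r x - c\<bar>) has_integral 0) {0..L}"
proof -
  have ratio: "(b' - a') * integral {a..b} r = (b - a) * integral {a'..b'} r"
    if ab: "0 < a" "a < b" "b < L" and ab': "0 < a'" "a' < b'" "b' < L" for a b a' b'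
  proof -
    define K where "K n = bump a b (1 / real (Suc n)) 1 0" for n
    define K' where "K' n = bump a' b' (1 / real (Suc n)) 1 0" for n
    \<comment> \<open>The factor \<open>1\<close> turns the total mass of a bump into an instance of
      the same limit lemma with \<open>r = 1\<close>, so these masses tend to the lengths of the
      intervals.\<close>
    have eq: "integral {0..L} (\<lambda>x. 1 * K' n x) * integral {0..L} (\<lambda>x. r x * K n x)
        = integral {0..L} (\<lambda>x. 1 * K n x) * integral {0..L} (\<lambda>x. r x * K' n x)" for n
    proof -
      have c: "1 / real (Suc n) > 0" by simp
      obtain \<psi> where \<psi>: "test_fun L \<psi>"
        "deriv \<psi> = (\<lambda>x. integral {0..L} (K' n) * K n x - integral {0..L} (K n) * K' n x)"
        unfolding K_def K'_def by (rule test_fun_difference_of_bumps[OF ab ab' c])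
      have rK: "(\<lambda>x. r x * K n x) integrable_on {0..L}" "(\<lambda>x. r x * K' n x) integrable_on {0..L}"
        unfolding K_def K'_def
        by (intro set_lebesgue_integral_eq_integral(1) absolutely_integrable_mult_continuous[OF r]
             continuous_on_bump ab ab' c)+
      have "0 = integral {0..L} (\<lambda>x. integral {0..L} (K' n) * (r x * K n x) - integral {0..L} (K n) * (r x * K' n x))"
        using orth[OF \<psi>(1)] unfolding \<psi>(2) by (simp add: algebra_simps)
      also have "\<dots> = integral {0..L} (\<lambda>x. integral {0..L} (K' n) * (r x * K n x))
           - integral {0..L} (\<lambda>x. integral {0..L} (K n) * (r x * K' n x))"
        by (intro integral_diff integrable_on_mult_right rK)
      finally show ?thesis by simp
    qed
    have one: "(\<lambda>_. 1 :: real) absolutely_integrable_on {0..L}"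
      by (intro absolutely_integrable_continuous_real continuous_intros)
    have "(\<lambda>n. integral {0..L} (\<lambda>x. 1 * K' n x) * integral {0..L} (\<lambda>x. r x * K n x))
       \<longlonglongrightarrow> integral {a'..b'} (\<lambda>_. 1) * integral {a..b} r"
      unfolding K_def K'_def by (intro tendsto_mult integral_mult_bump_tendsto one r ab ab')
    moreover have "(\<lambda>n. integral {0..L} (\<lambda>x. 1 * K' n x) * integral {0..L} (\<lambda>x. r x * K n x))
       \<longlonglongrightarrow> integral {a..b} (\<lambda>_. 1) * integral {a'..b'} r"
      unfolding eq unfolding K_def K'_def by (intro tendsto_mult integral_mult_bump_tendsto one r ab ab')
    ultimately have "integral {a'..b'} (\<lambda>_. 1) * integral {a..b} r = integral {a..b} (\<lambda>_. 1) * integral {a'..b'} r"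
      by (rule LIMSEQ_unique)
    then show ?thesis using ab ab' by simp
  qed
  \<comment> \<open>This is the mean of \<open>r\<close> over the middle half of the interval, whose
    length is \<open>L / 2\<close>; any fixed reference interval strictly inside would do.\<close>
  define c where "c = 2 / L * integral {L/4..3*L/4} r"
  have ri: "r integrable_on {0..L}" using r by (rule set_lebesgue_integral_eq_integral(1))
  have rci: "(\<lambda>x. r x - c) integrable_on {0..L}" by (intro integrable_diff ri) auto
  have rcs: "(\<lambda>x. r x - c) integrable_on {u..v}" if "{u..v} \<subseteq> {0..L}" for u v
    using integrable_on_subinterval[OF rci that] .
  have inner: "integral {u..v} (\<lambda>x. r x - c) = 0" if uv: "0 < u" "u < v" "v < L" for u v
  proof -
    have "(3*L/4 - L/4) * integral {u..v} r = (v - u) * integral {L/4..3*L/4} r"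
      using L by (intro ratio uv) auto
    then have "integral {u..v} r = (v - u) * c" using L by (simp add: c_def field_simps)
    moreover have "integral {u..v} (\<lambda>x. r x - c) = integral {u..v} r - integral {u..v} (\<lambda>x. c)"
      using uv by (intro integral_diff integrable_on_subinterval[OF ri]) auto
    ultimately show ?thesis using uv by simp
  qed
  define \<Phi> where "\<Phi> x = integral {0..x} (\<lambda>x. r x - c)" for x
  have diff: "\<Phi> v - \<Phi> u = integral {u..v} (\<lambda>x. r x - c)" if "0 \<le> u" "u \<le> v" "v \<le> L" for u v
    unfolding \<Phi>_def
    using Henstock_Kurzweil_Integration.integral_combine[of 0 u v "\<lambda>x. r x - c"] that rcs[of 0 v] by auto
  have cl: "closure {0<..<L} = {0..L}" using L by simp
  \<comment> \<open>Intervals that touch 0 or \<open>L\<close> are out of reach of test functions.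
    They are included by extending the constancy of the continuous primitive \<open>\<Phi>\<close>
    to the closure.\<close>
  have "continuous_on (closure {0<..<L}) \<Phi>"
    unfolding cl \<Phi>_def by (intro indefinite_integral_continuous_1 rci)
  moreover have inn: "\<Phi> x = \<Phi> (L/2)" if "x \<in> {0<..<L}" for x
    using inner[of x "L/2"] inner[of "L/2" x] diff[of x "L/2"] diff[of "L/2" x] that
    by (cases x "L/2" rule: linorder_cases) auto
  ultimately have const: "\<Phi> x = \<Phi> (L/2)" if "x \<in> {0..L}" for x
    using continuous_constant_on_closure[of "{0<..<L}" \<Phi> "\<Phi> (L/2)" x] that cl by blast
  have "((\<lambda>x. \<bar>r x - c\<bar>) has_integral 0) {0..L}"
  proof (rule has_integral_abs_0_if_integral_0[OF rci])
    fix u v :: real assume "u \<le> v" "{u..v} \<subseteq> {0..L}"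
    then show "integral {u..v} (\<lambda>x. r x - c) = 0"
      using diff[of u v] const[of u] const[of v] by auto
  qed
  then show thesis using that by blast
qed

section \<open>Passage from L2 to L1 on a bounded interval\<close>

lemma absolutely_integrable_if_L2_on:
  assumes "L2_on L f"
  shows "f absolutely_integrable_on {0..L}"
proof -
  have "f absolutely_integrable_on {0<..<L}"
  proof (rule measurable_bounded_by_integrable_imp_absolutely_integrable)
    show "f \<in> borel_measurable (lebesgue_on {0<..<L})" using assms by (simp add: L2_on_def)
    have "(\<lambda>x. (f x)\<^sup>2) integrable_on {0<..<L}"
      using assms by (intro integrable_on_lebesgue_on) (auto simp: L2_on_def)
    moreover have "(\<lambda>x. 1 :: real) integrable_on {0<..<L}"
      by (subst integrable_on_Icc_iff_Ioo[symmetric]) auto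
    ultimately show "(\<lambda>x. 1 + (f x)\<^sup>2) integrable_on {0<..<L}"
      by (intro integrable_add)
    show "norm (f x) \<le> 1 + (f x)\<^sup>2" for x
    proof -
      have "0 \<le> (\<bar>f x\<bar> - 1)\<^sup>2" "0 \<le> \<bar>f x\<bar>" by auto
      then show ?thesis by (simp add: power2_diff)
    qed
  qed auto
  then show ?thesis by (simp add: absolutely_integrable_on_Icc_iff_Ioo)
qed

text \<open>The Cauchy-Schwarz inequality against the constant 1, obtained by integrating (|f| -
  m/L)^2 \<ge> 0, where m/L is the mean of |f|.\<close>

lemma integral_abs_le_L2:
  assumes L: "0 < L" and f: "L2_on L f"
  shows "(integral {0..L} (\<lambda>x. \<bar>f x\<bar>))\<^sup>2 \<le> L * integral\<^sup>L (lebesgue_on {0<..<L}) (\<lambda>x. (f x)\<^sup>2)"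
proof -
  define m where "m = integral {0..L} (\<lambda>x. \<bar>f x\<bar>)"
  have sq: "integrable (lebesgue_on {0<..<L}) (\<lambda>x. (f x)\<^sup>2)" using f by (simp add: L2_on_def)
  have e: "integral\<^sup>L (lebesgue_on {0<..<L}) (\<lambda>x. (f x)\<^sup>2) = integral {0..L} (\<lambda>x. (f x)\<^sup>2)"
    using sq by (simp add: lebesgue_integral_eq_integral integral_open_interval_real)
  have sqi: "(\<lambda>x. (f x)\<^sup>2) integrable_on {0..L}"
    using integrable_on_lebesgue_on[OF sq] by (simp add: integrable_on_Icc_iff_Ioo)
  have ai: "(\<lambda>x. \<bar>f x\<bar>) integrable_on {0..L}"
    using absolutely_integrable_if_L2_on[OF f] by (auto simp: absolutely_integrable_on_def)
  have i1: "(\<lambda>x. (2 * m / L) * \<bar>f x\<bar>) integrable_on {0..L}"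
    by (intro integrable_on_mult_right ai)
  have "0 \<le> integral {0..L} (\<lambda>x. (f x)\<^sup>2 - (2 * m / L) * \<bar>f x\<bar> + (m / L)\<^sup>2)"
  proof (rule integral_nonneg)
    show "(\<lambda>x. (f x)\<^sup>2 - (2 * m / L) * \<bar>f x\<bar> + (m / L)\<^sup>2) integrable_on {0..L}"
      by (intro integrable_add integrable_diff sqi i1) auto
    show "0 \<le> (f x)\<^sup>2 - (2 * m / L) * \<bar>f x\<bar> + (m / L)\<^sup>2" for x
      using zero_le_power2[of "\<bar>f x\<bar> - m / L"] by (simp add: power2_diff mult_ac)
  qed
  also have "\<dots> = integral {0..L} (\<lambda>x. (f x)\<^sup>2 - (2 * m / L) * \<bar>f x\<bar>) + integral {0..L} (\<lambda>x. (m / L)\<^sup>2)"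
    by (intro integral_add integrable_diff sqi i1) auto
  also have "\<dots> = integral {0..L} (\<lambda>x. (f x)\<^sup>2) - (2 * m / L) * m + (m / L)\<^sup>2 * L"
    using L by (subst integral_diff[OF sqi i1]) (simp add: m_def)
  also have "\<dots> = integral {0..L} (\<lambda>x. (f x)\<^sup>2) - m\<^sup>2 / L"
    using L by (simp add: power2_eq_square field_simps)
  finally show ?thesis using L unfolding e m_def by (simp add: field_simps)
qed

text \<open>With G the primitive of \<open>g\<close> from 0, the difference f - G is orthogonal to
  the derivatives of test functions, so du Bois-Reymond makes it constant almost everywhere.
  Integrating G * \<psi>' by parts leaves no boundary terms, since G vanishes at 0 and \<psi> at
  L.\<close>

lemma weak_deriv_representative:
  assumes L: "0 < L" and w: "weak_deriv_H1 L f g"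
  obtains c where "((\<lambda>x. \<bar>f x - (c + integral {0..x} g)\<bar>) has_integral 0) {0..L}"
proof -
  have L2: "L2_on L f" "L2_on L g" using w by (auto simp: weak_deriv_H1_def)
  have f: "f absolutely_integrable_on {0..L}" and g: "g absolutely_integrable_on {0..L}"
    using L2 by (auto intro: absolutely_integrable_if_L2_on)
  define G where "G x = integral {0..x} g" for x
  have cG: "continuous_on {0..L} G"
    unfolding G_def by (intro indefinite_integral_continuous_1 set_lebesgue_integral_eq_integral(1) g)
  have G: "G absolutely_integrable_on {0..L}"
    by (intro absolutely_integrable_continuous_real cG)
  have fG: "(\<lambda>x. f x - G x) absolutely_integrable_on {0..L}" by (intro set_integral_diff f G)
  obtain c where "((\<lambda>x. \<bar>(f x - G x) - c\<bar>) has_integral 0) {0..L}"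
  proof (rule du_Bois_Reymond[OF L fG])
    fix \<psi> assume \<psi>: "test_fun L \<psi>"
    have d0: "\<psi> differentiable (at x)" and d1: "deriv \<psi> differentiable (at x)" for x
      using \<psi> unfolding test_fun_def by (metis funpow_0, metis funpow.simps(2) comp_apply funpow_0)
    have D: "(\<psi> has_real_derivative deriv \<psi> x) (at x within S)" for x S
      using d0[of x] by (meson DERIV_deriv_iff_real_differentiable DERIV_subset subset_UNIV)
    have c0: "continuous_on {0..L} \<psi>" and c1: "continuous_on {0..L} (deriv \<psi>)"
      using d0 d1 by (auto intro!: continuous_at_imp_continuous_on differentiable_imp_continuous_within)
    have "L \<notin> {0<..<L}" by simp
    then have \<psi>L: "\<psi> L = 0" using \<psi> closure_subset[of "{x. \<psi> x \<noteq> 0}"] unfolding test_fun_def by blast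
    have conv: "integral\<^sup>L (lebesgue_on {0<..<L}) (\<lambda>x. u x * v x) = integral {0..L} (\<lambda>x. u x * v x)"
      if "u absolutely_integrable_on {0..L}" "continuous_on {0..L} v" for u v :: "real \<Rightarrow> real"
    proof -
      have "(\<lambda>x. u x * v x) absolutely_integrable_on {0<..<L}"
        using absolutely_integrable_mult_continuous[OF that] by (simp add: absolutely_integrable_on_Icc_iff_Ioo)
      then have "integrable (lebesgue_on {0<..<L}) (\<lambda>x. u x * v x)"
        by (simp add: set_integrable_def integrable_restrict_space)
      then show ?thesis by (simp add: lebesgue_integral_eq_integral integral_open_interval_real)
    qed
    have "integral {0..L} (\<lambda>x. f x * deriv \<psi> x) = - integral {0..L} (\<lambda>x. g x * \<psi> x)"
      using w \<psi> conv[OF f c1] conv[OF g c0] by (simp add: weak_deriv_H1_def)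
    also have "\<dots> = integral {0..L} (\<lambda>x. G x * deriv \<psi> x)"
      unfolding G_def using L \<psi>L by (subst integral_by_parts_primitive[OF _ g D c1]) auto
    finally have "integral {0..L} (\<lambda>x. f x * deriv \<psi> x) = integral {0..L} (\<lambda>x. G x * deriv \<psi> x)" .
    moreover have "integral {0..L} (\<lambda>x. (f x - G x) * deriv \<psi> x)
        = integral {0..L} (\<lambda>x. f x * deriv \<psi> x) - integral {0..L} (\<lambda>x. G x * deriv \<psi> x)"
      unfolding left_diff_distrib
      by (intro integral_diff set_lebesgue_integral_eq_integral(1) absolutely_integrable_mult_continuous f G c1)
    ultimately show "integral {0..L} (\<lambda>x. (f x - G x) * deriv \<psi> x) = 0" by simp
  qed
  then have "((\<lambda>x. \<bar>f x - (c + integral {0..x} g)\<bar>) has_integral 0) {0..L}"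
    by (simp add: G_def algebra_simps)
  then show thesis using that by blast
qed

section \<open>Energy estimate and Green's function\<close>

text \<open>This is the embedding of H^1 into the bounded functions in quantitative form. The
  representative F varies by at most N, the integral of |g|, so |F x| \<le> |f y| + |f y - F y| + N
  for all y; averaging over y removes the middle term.\<close>

lemma weak_deriv_representative_bounded:
  assumes L: "0 < L" and w: "weak_deriv_H1 L f g"
  obtains c where "((\<lambda>x. \<bar>f x - (c + integral {0..x} g)\<bar>) has_integral 0) {0..L}"
    "\<And>x. x \<in> {0..L} \<Longrightarrow>
       \<bar>c + integral {0..x} g\<bar> \<le> integral {0..L} (\<lambda>x. \<bar>f x\<bar>) / L + integral {0..L} (\<lambda>x. \<bar>g x\<bar>)"
proof -
  obtain c where c: "((\<lambda>x. \<bar>f x - (c + integral {0..x} g)\<bar>) has_integral 0) {0..L}"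
    using weak_deriv_representative[OF L w] .
  define F where "F x = c + integral {0..x} g" for x
  define N where "N = integral {0..L} (\<lambda>x. \<bar>g x\<bar>)"
  have f: "f absolutely_integrable_on {0..L}" and g: "g absolutely_integrable_on {0..L}"
    using w by (auto simp: weak_deriv_H1_def intro: absolutely_integrable_if_L2_on)
  have fi: "(\<lambda>x. \<bar>f x\<bar>) integrable_on {0..L}" and gi: "g integrable_on {0..L}"
    and agi: "(\<lambda>x. \<bar>g x\<bar>) integrable_on {0..L}"
    using f g by (auto simp: absolutely_integrable_on_def)
  have step: "\<bar>F y - F x\<bar> \<le> N" if xy: "0 \<le> x" "x \<le> y" "y \<le> L" for x y
  proof -
    have sub: "{x..y} \<subseteq> {0..L}" using xy by auto
    have "F y - F x = integral {x..y} g"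
      unfolding F_def
      using Henstock_Kurzweil_Integration.integral_combine[of 0 x y g] xy
        integrable_on_subinterval[OF gi, of 0 y] by auto
    also have "norm \<dots> \<le> integral {x..y} (\<lambda>x. \<bar>g x\<bar>)"
      by (intro integral_norm_bound_integral integrable_on_subinterval[OF gi sub]
          integrable_on_subinterval[OF agi sub]) auto
    also have "\<dots> \<le> N"
      unfolding N_def by (intro integral_subset_le sub agi integrable_on_subinterval[OF agi sub]) auto
    finally show ?thesis by simp
  qed
  have "\<bar>F x\<bar> \<le> integral {0..L} (\<lambda>x. \<bar>f x\<bar>) / L + N" if x: "x \<in> {0..L}" for x
  proof -
    have di: "(\<lambda>y. \<bar>f y - F y\<bar>) integrable_on {0..L}" using c unfolding F_def by blast
    have "\<bar>F x\<bar> * L = integral {0..L} (\<lambda>y. \<bar>F x\<bar>)" using L by simp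
    also have "\<dots> \<le> integral {0..L} (\<lambda>y. \<bar>f y\<bar> + \<bar>f y - F y\<bar> + N)"
    proof (rule integral_le)
      show "(\<lambda>y. \<bar>f y\<bar> + \<bar>f y - F y\<bar> + N) integrable_on {0..L}"
        by (intro integrable_add fi di) auto
      show "\<bar>F x\<bar> \<le> \<bar>f y\<bar> + \<bar>f y - F y\<bar> + N" if "y \<in> {0..L}" for y
        using step[of x y] step[of y x] x that by (cases "x \<le> y") auto
    qed auto
    also have "\<dots> = integral {0..L} (\<lambda>y. \<bar>f y\<bar> + \<bar>f y - F y\<bar>) + integral {0..L} (\<lambda>y. N)"
      by (intro integral_add integrable_add fi di) auto
    also have "\<dots> = integral {0..L} (\<lambda>y. \<bar>f y\<bar>) + N * L"
      using integral_unique[OF c] L by (subst integral_add[OF fi di]) (simp add: F_def)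
    finally show ?thesis using L by (simp add: field_simps)
  qed
  then show thesis using that c unfolding F_def N_def by blast
qed

section \<open>Energy bound for solutions and the gain from integration by parts\<close>

text \<open>Gronwall runs backwards, from \<open>x\<close> down to \<open>t\<close>, because the
  data of the kernels are known at the right end. With E the energy, E' \<ge> -\<mu> E makes E(s)
  exp(\<mu> s) nondecreasing.\<close>

lemma solution_energy_bound:
  assumes sol: "is_solution L P \<tau> k dk" and P0: "P0 > 0"
    and P: "\<And>t. t \<in> {0..L} \<Longrightarrow> P0 \<le> P t"
    and P': "\<And>t. t \<in> {0..L} \<Longrightarrow> (P has_real_derivative P' t) (at t within {0..L})"
    and D: "\<And>t. t \<in> {0..L} \<Longrightarrow> \<bar>P' t\<bar> \<le> D" "0 \<le> D"
    and tx: "0 \<le> t" "t \<le> x" "x \<le> L"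
  shows "P t * (dk t)\<^sup>2 + \<tau>\<^sup>2 * (k t)\<^sup>2 \<le> exp (D / P0 * L) * (P x * (dk x)\<^sup>2 + \<tau>\<^sup>2 * (k x)\<^sup>2)"
proof -
  \<comment> \<open>The choice reflects |P'| dk^2 \<le> D dk^2 \<le> (D/P0) E, so that
    \<open>\<mu> * E s\<close> outweighs the derivative of the energy.\<close>
  define \<mu> where "\<mu> = D / P0"
  have \<mu>: "0 \<le> \<mu>" using D P0 by (simp add: \<mu>_def)
  define E where "E s = P s * (dk s)\<^sup>2 + \<tau>\<^sup>2 * (k s)\<^sup>2" for s
  have sub: "{t..x} \<subseteq> {0..L}" using tx by auto
  have der: "((\<lambda>s. E s * exp (\<mu> * s)) has_real_derivative (P' s * (dk s)\<^sup>2 + \<mu> * E s) * exp (\<mu> * s))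
      (at s within {t..x})" if s: "s \<in> {t..x}" for s
  proof -
    have s': "s \<in> {0..L}" using s sub by auto
    have "P s > 0" using P[OF s'] P0 by linarith
    have d: "(P has_real_derivative P' s) (at s within {t..x})"
      "(k has_real_derivative dk s) (at s within {t..x})"
      "(dk has_real_derivative (- (\<tau>\<^sup>2 / P s) * k s)) (at s within {t..x})"
      using P'[OF s'] sol s' unfolding is_solution_def by (auto intro: DERIV_subset[OF _ sub])
    have "((\<lambda>s. E s * exp (\<mu> * s)) has_real_derivative
       (P' s * (dk s)\<^sup>2 + P s * (2 * dk s * (- (\<tau>\<^sup>2 / P s) * k s)) + \<tau>\<^sup>2 * (2 * k s * dk s)) * exp (\<mu> * s)
         + E s * (exp (\<mu> * s) * \<mu>)) (at s within {t..x})"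
      unfolding E_def by (auto intro!: derivative_eq_intros d)
    also have "(P' s * (dk s)\<^sup>2 + P s * (2 * dk s * (- (\<tau>\<^sup>2 / P s) * k s)) + \<tau>\<^sup>2 * (2 * k s * dk s)) * exp (\<mu> * s)
         + E s * (exp (\<mu> * s) * \<mu>) = (P' s * (dk s)\<^sup>2 + \<mu> * E s) * exp (\<mu> * s)"
      using \<open>P s > 0\<close> by (simp add: algebra_simps)
    finally show ?thesis .
  qed
  obtain s where s: "s \<in> {t..x}" and mvt: "E x * exp (\<mu> * x) - E t * exp (\<mu> * t)
      = (P' s * (dk s)\<^sup>2 + \<mu> * E s) * exp (\<mu> * s) * (x - t)"
    using mvt_very_simple[OF tx(2), of "\<lambda>s. E s * exp (\<mu> * s)"
        "\<lambda>s h. (P' s * (dk s)\<^sup>2 + \<mu> * E s) * exp (\<mu> * s) * h"] der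
    by (auto simp: has_field_derivative_def)
  have s': "s \<in> {0..L}" using s sub by auto
  have "D * (dk s)\<^sup>2 = \<mu> * (P0 * (dk s)\<^sup>2)" using P0 by (simp add: \<mu>_def)
  also have "\<dots> \<le> \<mu> * E s"
    unfolding E_def using \<mu> P[OF s'] by (intro mult_left_mono add_increasing2 mult_right_mono) auto
  finally have "0 \<le> P' s * (dk s)\<^sup>2 + \<mu> * E s"
    using mult_right_mono[of "- P' s" D "(dk s)\<^sup>2"] abs_le_D2[OF D(1)[OF s']] by simp
  then have "0 \<le> (P' s * (dk s)\<^sup>2 + \<mu> * E s) * exp (\<mu> * s) * (x - t)" using tx by simp
  then have "E t * exp (\<mu> * t) \<le> E x * exp (\<mu> * x)" using mvt by linarith
  then have "E t \<le> E x * exp (\<mu> * x) / exp (\<mu> * t)" by (simp add: pos_le_divide_eq)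
  also have "\<dots> = exp (\<mu> * (x - t)) * E x" by (simp add: exp_diff right_diff_distrib)
  also have "\<dots> \<le> exp (\<mu> * L) * E x"
  proof (rule mult_right_mono)
    have "x \<in> {0..L}" using tx by auto
    then show "0 \<le> E x" unfolding E_def using P[of x] P0 by auto
    show "exp (\<mu> * (x - t)) \<le> exp (\<mu> * L)" using \<mu> tx by (auto intro!: mult_left_mono)
  qed
  finally show ?thesis unfolding E_def \<mu>_def .
qed

text \<open>Since \<open>\<tau>\<^sup>2 * k = P' * k' - (P * k')'\<close>, integration by parts moves the derivative onto
  \<open>c + integral {0..t} g\<close> and gains the factor \<open>1 / \<tau>\<^sup>2\<close>.\<close>
lemma integral_mult_solution_le:
  assumes sol: "is_solution L P \<tau> k dk" and \<tau>: "\<tau> \<noteq> 0" and x: "x \<in> {0..L}"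
    and P: "\<And>t. t \<in> {0..L} \<Longrightarrow> 0 < P t \<and> P t \<le> P1"
    and P': "\<And>t. t \<in> {0..L} \<Longrightarrow> (P has_real_derivative P' t) (at t within {0..L})"
      "continuous_on {0..L} P'"
    and D: "\<And>t. t \<in> {0..L} \<Longrightarrow> \<bar>P' t\<bar> \<le> D"
    and g: "g absolutely_integrable_on {0..L}"
    and S: "\<And>t. t \<in> {0..L} \<Longrightarrow> \<bar>c + integral {0..t} g\<bar> \<le> S"
    and B: "\<And>t. t \<in> {0..x} \<Longrightarrow> \<bar>dk t\<bar> \<le> B"
  shows "\<bar>integral {0..x} (\<lambda>t. (c + integral {0..t} g) * k t)\<bar>
      \<le> (2 * P1 * S + P1 * integral {0..L} (\<lambda>t. \<bar>g t\<bar>) + D * L * S) * B / \<tau>\<^sup>2"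
proof -
  define G where "G t = integral {0..t} g" for t
  define F where "F t = c + G t" for t
  define h where "h t = P t * dk t" for t
  \<comment> \<open>The derivative of \<open>h\<close>: the differential equation makes the factor
    \<open>P t\<close> cancel against the coefficient \<open>\<tau>\<^sup>2 / P t\<close>.\<close>
  define h' where "h' t = P' t * dk t - \<tau>\<^sup>2 * k t" for t
  have x0: "0 \<le> x" "x \<le> L" using x by auto
  have sub: "{0..x} \<subseteq> {0..L}" using x by auto
  have gx: "g absolutely_integrable_on {0..x}"
    using absolutely_integrable_on_subinterval[OF g sub] .
  have d: "(P has_real_derivative P' t) (at t within {0..x})"
      "(k has_real_derivative dk t) (at t within {0..x})"
      "(dk has_real_derivative (- (\<tau>\<^sup>2 / P t) * k t)) (at t within {0..x})" if t: "t \<in> {0..x}" for t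
    using P'(1) sol t sub unfolding is_solution_def by (auto intro!: DERIV_subset[OF _ sub])
  have dh: "(h has_real_derivative h' t) (at t within {0..x})" if t: "t \<in> {0..x}" for t
  proof -
    have "P t > 0" using P t sub by auto
    then have "P' t * dk t + P t * (- (\<tau>\<^sup>2 / P t) * k t) = h' t" by (simp add: h'_def)
    then show ?thesis
      unfolding h_def using DERIV_mult[OF d(1)[OF t] d(3)[OF t]] by (simp add: algebra_simps)
  qed
  have ck: "continuous_on {0..x} k" by (rule DERIV_continuous_on[OF d(2)])
  have cdk: "continuous_on {0..x} dk" by (rule DERIV_continuous_on[OF d(3)])
  have ch: "continuous_on {0..x} h" by (rule DERIV_continuous_on[OF dh])
  have cP': "continuous_on {0..x} P'" using P'(2) sub by (rule continuous_on_subset)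
  have ch': "continuous_on {0..x} h'" unfolding h'_def by (intro continuous_intros ck cdk cP')
  have cG: "continuous_on {0..x} G"
    unfolding G_def by (intro indefinite_integral_continuous_1 set_lebesgue_integral_eq_integral(1) gx)
  have cF: "continuous_on {0..x} F" unfolding F_def by (intro continuous_intros cG)
  have hb: "\<bar>h t\<bar> \<le> P1 * B" if "t \<in> {0..x}" for t
  proof -
    have "0 < P t" "P t \<le> P1" "\<bar>dk t\<bar> \<le> B" using P B that sub by auto
    then show ?thesis unfolding h_def by (auto simp: abs_mult intro!: mult_mono)
  qed
  have B0: "0 \<le> B" using B[of 0] x0 by force
  have Fb: "\<bar>F t\<bar> \<le> S" if "t \<in> {0..x}" for t using S[of t] that sub by (auto simp: F_def G_def)
  have S0: "0 \<le> S" using Fb[of 0] x0 by force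
  have D0: "0 \<le> D" using D[of 0] x0 by force
  have P10: "0 \<le> P1" using P[of 0] x0 by force
  have ftc: "integral {0..x} h' = h x - h 0"
    using dh x0
    by (intro integral_unique fundamental_theorem_of_calculus)
       (auto simp: has_real_derivative_iff_has_vector_derivative[symmetric])
  \<comment> \<open>The constant \<open>c\<close> is split off because
    \<open>integral_by_parts_primitive\<close> treats a primitive vanishing at the left end; the
    constant part is the fundamental theorem of calculus.\<close>
  have "integral {0..x} (\<lambda>t. F t * h' t) = integral {0..x} (\<lambda>t. c * h' t) + integral {0..x} (\<lambda>t. G t * h' t)"
    unfolding F_def distrib_right
    by (intro integral_add integrable_continuous_real continuous_intros ch' cG)
  also have "\<dots> = c * (h x - h 0) + (G x * h x - integral {0..x} (\<lambda>t. g t * h t))"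
    using integral_by_parts_primitive[OF x0(1) gx dh ch'] ftc by (simp add: G_def)
  also have "\<dots> = F x * h x - F 0 * h 0 - integral {0..x} (\<lambda>t. g t * h t)"
    by (simp add: F_def G_def algebra_simps)
  finally have parts: "integral {0..x} (\<lambda>t. F t * h' t)
      = F x * h x - F 0 * h 0 - integral {0..x} (\<lambda>t. g t * h t)" .
  have "\<tau>\<^sup>2 * integral {0..x} (\<lambda>t. F t * k t) = integral {0..x} (\<lambda>t. F t * (P' t * dk t) - F t * h' t)"
    unfolding integral_mult_right[symmetric] by (simp add: h'_def algebra_simps)
  also have "\<dots> = integral {0..x} (\<lambda>t. F t * (P' t * dk t)) - integral {0..x} (\<lambda>t. F t * h' t)"
    by (intro integral_diff integrable_continuous_real continuous_intros cF cP' cdk ch')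
  finally have eq: "\<tau>\<^sup>2 * integral {0..x} (\<lambda>t. F t * k t)
      = integral {0..x} (\<lambda>t. F t * (P' t * dk t)) - integral {0..x} (\<lambda>t. F t * h' t)" .
  have b1: "\<bar>integral {0..x} (\<lambda>t. F t * (P' t * dk t))\<bar> \<le> S * (D * B) * L"
  proof -
    have "norm (integral (cbox 0 x) (\<lambda>t. F t * (P' t * dk t))) \<le> S * (D * B) * measure lborel (cbox 0 x)"
    proof (rule integrable_bound)
      show "(\<lambda>t. F t * (P' t * dk t)) integrable_on cbox 0 x"
        unfolding box_real by (intro integrable_continuous_real continuous_intros cF cP' cdk)
      show "norm (F t * (P' t * dk t)) \<le> S * (D * B)" if "t \<in> cbox 0 x" for t
        using Fb[of t] D[of t] B[of t] that sub S0 D0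
        by (auto simp: abs_mult intro!: mult_mono)
    qed (use S0 D0 B0 in simp)
    also have "\<dots> \<le> S * (D * B) * L" using x0 S0 D0 B0 by (auto intro!: mult_left_mono)
    finally show ?thesis by simp
  qed
  have b2: "\<bar>integral {0..x} (\<lambda>t. g t * h t)\<bar> \<le> integral {0..L} (\<lambda>t. \<bar>g t\<bar>) * (P1 * B)"
  proof -
    have "(\<lambda>t. \<bar>g t\<bar>) integrable_on {0..x}" "(\<lambda>t. \<bar>g t\<bar>) integrable_on {0..L}"
      using g gx by (auto simp: absolutely_integrable_on_def)
    then have "integral {0..x} (\<lambda>t. \<bar>g t\<bar>) \<le> integral {0..L} (\<lambda>t. \<bar>g t\<bar>)"
      by (intro integral_subset_le sub) auto
    then show ?thesis
      using abs_integral_mult_le[OF gx ch hb] mult_right_mono[of _ _ "P1 * B"] P10 B0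
      by (meson mult_nonneg_nonneg order_trans)
  qed
  have b3: "\<bar>F t * h t\<bar> \<le> S * (P1 * B)" if "t \<in> {0..x}" for t
    unfolding abs_mult using Fb[OF that] hb[OF that] S0 by (intro mult_mono) auto
  \<comment> \<open>The three summands come from the term with \<open>P'\<close>, from the boundary
    values at \<open>x\<close> and 0 (\<open>F 0 = c\<close> need not vanish), and from the
    derivative moved onto \<open>F\<close>.\<close>
  have "\<bar>\<tau>\<^sup>2 * integral {0..x} (\<lambda>t. F t * k t)\<bar>
      \<le> S * (D * B) * L + 2 * (S * (P1 * B)) + integral {0..L} (\<lambda>t. \<bar>g t\<bar>) * (P1 * B)"
    unfolding eq parts using b1 b2 b3[of x] b3[of 0] x0 by auto
  then have "\<tau>\<^sup>2 * \<bar>integral {0..x} (\<lambda>t. F t * k t)\<bar>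
      \<le> (2 * P1 * S + P1 * integral {0..L} (\<lambda>t. \<bar>g t\<bar>) + D * L * S) * B"
    by (simp add: abs_mult algebra_simps)
  then show ?thesis using \<tau> by (simp add: F_def G_def field_simps)
qed

text \<open>The kernel enters only through the bound \<open>Q\<close> for its energy at the single
  point \<open>x\<close>, which controls \<open>dk\<close> on all of \<open>{0..x}\<close>. The
  remaining constant arises from bounding the L1 norms of \<open>f\<close> and \<open>g\<close> by
  \<open>sqrt L\<close> times the H^1 norm.\<close>

lemma lebesgue_integral_mult_solution_le:
  assumes L: "0 < L" and sol: "is_solution L P \<tau> k dk" and \<tau>: "\<tau> \<noteq> 0" and x: "x \<in> {0..L}"
    and P0: "P0 > 0" and P: "\<And>t. t \<in> {0..L} \<Longrightarrow> P0 \<le> P t \<and> P t \<le> P1"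
    and P': "\<And>t. t \<in> {0..L} \<Longrightarrow> (P has_real_derivative P' t) (at t within {0..L})"
      "continuous_on {0..L} P'"
    and D: "\<And>t. t \<in> {0..L} \<Longrightarrow> \<bar>P' t\<bar> \<le> D"
    and Q: "P x * (dk x)\<^sup>2 + \<tau>\<^sup>2 * (k x)\<^sup>2 \<le> Q"
    and f: "in_H1 L f"
  shows "\<bar>integral\<^sup>L (lebesgue_on {0..x}) (\<lambda>t. f t * k t)\<bar>
     \<le> ((2 * P1 + D * L) * (sqrt L / L + sqrt L) + P1 * sqrt L)
         * sqrt (exp (D / P0 * L) * Q / P0) / \<tau>\<^sup>2 * H1_norm L f"
proof -
  \<comment> \<open>The same choice as in \<open>H1_norm\<close>, so that the L2 norm of this very
    \<open>g\<close> is part of the norm.\<close>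
  define g where "g = (SOME g. weak_deriv_H1 L f g)"
  have w: "weak_deriv_H1 L f g"
    using f unfolding in_H1_def g_def by (rule someI_ex)
  have L2: "L2_on L f" "L2_on L g" using w by (auto simp: weak_deriv_H1_def)
  have fa: "f absolutely_integrable_on {0..L}" and ga: "g absolutely_integrable_on {0..L}"
    using L2 by (auto intro: absolutely_integrable_if_L2_on)
  define H where "H = H1_norm L f"
  define N where "N = integral {0..L} (\<lambda>x. \<bar>g x\<bar>)"
  define M where "M = integral {0..L} (\<lambda>x. \<bar>f x\<bar>)"
  define B where "B = sqrt (exp (D / P0 * L) * Q / P0)"
  have sqrt_bound: "integral {0..L} (\<lambda>x. \<bar>u x\<bar>) \<le> sqrt L * H"
    if "L2_on L u" "integral\<^sup>L (lebesgue_on {0<..<L}) (\<lambda>x. (u x)\<^sup>2) \<le> H\<^sup>2" for u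
  proof (rule power2_le_imp_le)
    have "L * integral\<^sup>L (lebesgue_on {0<..<L}) (\<lambda>x. (u x)\<^sup>2) \<le> L * H\<^sup>2"
      using that L by (intro mult_left_mono) auto
    then show "(integral {0..L} (\<lambda>x. \<bar>u x\<bar>))\<^sup>2 \<le> (sqrt L * H)\<^sup>2"
      using order_trans[OF integral_abs_le_L2[OF L that(1)]] L by (simp add: power_mult_distrib)
    show "0 \<le> sqrt L * H" using L by (simp add: H_def H1_norm_def)
  qed
  have nn: "0 \<le> integral\<^sup>L (lebesgue_on {0<..<L}) (\<lambda>x. (u x)\<^sup>2)" for u :: "real \<Rightarrow> real"
    by simp
  have H2: "H\<^sup>2 = integral\<^sup>L (lebesgue_on {0<..<L}) (\<lambda>x. (f x)\<^sup>2)
      + integral\<^sup>L (lebesgue_on {0<..<L}) (\<lambda>x. (g x)\<^sup>2)"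
    unfolding H_def H1_norm_def g_def[symmetric] using nn[of f] nn[of g] by simp
  have M: "M \<le> sqrt L * H" and N: "N \<le> sqrt L * H"
    unfolding M_def N_def using L2 H2 nn[of f] nn[of g] by (auto intro!: sqrt_bound)
  obtain c where c: "((\<lambda>x. \<bar>f x - (c + integral {0..x} g)\<bar>) has_integral 0) {0..L}"
    "\<And>x. x \<in> {0..L} \<Longrightarrow> \<bar>c + integral {0..x} g\<bar> \<le> M / L + N"
    unfolding M_def N_def by (rule weak_deriv_representative_bounded[OF L w]) blast
  define F where "F x = c + integral {0..x} g" for x
  have sub: "{0..x} \<subseteq> {0..L}" using x by auto
  have ck: "continuous_on {0..x} k"
    using sol continuous_on_subset[OF DERIV_continuous_on sub, of k dk] by (auto simp: is_solution_def)
  have D0: "0 \<le> D" using D[of 0] L by force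
  have P10: "0 \<le> P1" using P[of 0] P0 L by force
  have Q0: "0 \<le> Q" using Q P[OF x] P0 by (smt (verit) mult_nonneg_nonneg zero_le_power2)
  have B0: "0 \<le> B" using Q0 P0 by (simp add: B_def)
  have fx: "f absolutely_integrable_on {0..x}"
    using absolutely_integrable_on_subinterval[OF fa sub] .
  have cF: "continuous_on {0..x} F"
    unfolding F_def
    by (intro continuous_intros continuous_on_subset[OF _ sub]
        indefinite_integral_continuous_1 set_lebesgue_integral_eq_integral(1) ga)
  have Fx: "F absolutely_integrable_on {0..x}"
    by (intro absolutely_integrable_continuous_real cF)
  have dka: "\<bar>dk t\<bar> \<le> B" if t: "t \<in> {0..x}" for t
  proof -
    have t': "0 \<le> t" "t \<le> x" "x \<le> L" "t \<in> {0..L}" using t x by auto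
    have "P0 * (dk t)\<^sup>2 \<le> P t * (dk t)\<^sup>2 + \<tau>\<^sup>2 * (k t)\<^sup>2"
      using P[OF t'(4)] by (intro add_increasing2 mult_right_mono) auto
    also have "\<dots> \<le> exp (D / P0 * L) * (P x * (dk x)\<^sup>2 + \<tau>\<^sup>2 * (k x)\<^sup>2)"
      by (rule solution_energy_bound[OF sol P0 _ P'(1) D D0 t'(1-3)]) (use P in auto)
    also have "\<dots> \<le> exp (D / P0 * L) * Q" using Q by (intro mult_left_mono) auto
    finally have "(dk t)\<^sup>2 \<le> exp (D / P0 * L) * Q / P0" using P0 by (simp add: field_simps)
    then show ?thesis unfolding B_def by (metis real_sqrt_abs real_sqrt_le_iff)
  qed
  have "integral\<^sup>L (lebesgue_on {0..x}) (\<lambda>t. f t * k t) = integral {0..x} (\<lambda>t. f t * k t)"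
    using absolutely_integrable_mult_continuous[OF fx ck]
    by (intro lebesgue_integral_eq_integral) (auto simp: set_integrable_def integrable_restrict_space)
  \<comment> \<open>Replacing \<open>f\<close> by its representative is harmless, since |f - F| has
    integral 0 and \<open>k\<close> is bounded on \<open>{0..x}\<close>.\<close>
  also have "\<dots> = integral {0..x} (\<lambda>t. F t * k t)"
  proof -
    have "bounded (k ` {0..x})"
      by (intro compact_imp_bounded compact_continuous_image ck compact_Icc)
    then obtain b where "0 < b" and b: "\<And>t. t \<in> {0..x} \<Longrightarrow> \<bar>k t\<bar> \<le> b"
      unfolding bounded_pos by auto
    have fF: "(\<lambda>t. f t - F t) absolutely_integrable_on {0..x}" by (intro set_integral_diff fx Fx)
    have "integral {0..x} (\<lambda>t. \<bar>f t - F t\<bar>) \<le> integral {0..L} (\<lambda>t. \<bar>f t - F t\<bar>)"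
      using c(1) fF by (intro integral_subset_le sub) (auto simp: F_def absolutely_integrable_on_def)
    also have "\<dots> = 0" using c(1) by (simp add: F_def integral_unique)
    finally have "integral {0..x} (\<lambda>t. \<bar>f t - F t\<bar>) = 0"
      using fF by (intro antisym integral_nonneg) (auto simp: absolutely_integrable_on_def)
    then have "integral {0..x} (\<lambda>t. (f t - F t) * k t) = 0"
      using abs_integral_mult_le[OF fF ck b] by simp
    moreover have "integral {0..x} (\<lambda>t. (f t - F t) * k t)
        = integral {0..x} (\<lambda>t. f t * k t) - integral {0..x} (\<lambda>t. F t * k t)"
      unfolding left_diff_distrib
      by (intro integral_diff set_lebesgue_integral_eq_integral(1) absolutely_integrable_mult_continuous fx Fx ck)
    ultimately show ?thesis by simp
  qed
  also have "\<bar>\<dots>\<bar> \<le> (2 * P1 * (M / L + N) + P1 * N + D * L * (M / L + N)) * B / \<tau>\<^sup>2"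
    unfolding F_def N_def
  proof (rule integral_mult_solution_le[OF sol \<tau> x _ P' D ga])
    show "0 < P t \<and> P t \<le> P1" if "t \<in> {0..L}" for t using P[OF that] P0 by auto
    show "\<bar>c + integral {0..t} g\<bar> \<le> M / L + integral {0..L} (\<lambda>x. \<bar>g x\<bar>)" if "t \<in> {0..L}" for t
      using c(2)[OF that] by (simp add: N_def)
  qed (auto intro: dka)
  also have "\<dots> = ((2 * P1 + D * L) * (M / L + N) + P1 * N) * B / \<tau>\<^sup>2" by (simp add: algebra_simps)
  also have "\<dots> \<le> ((2 * P1 + D * L) * (sqrt L * H / L + sqrt L * H) + P1 * (sqrt L * H)) * B / \<tau>\<^sup>2"
    using M N L D0 P10 B0
    by (intro divide_right_mono mult_right_mono add_mono mult_left_mono) auto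
  also have "\<dots> = ((2 * P1 + D * L) * (sqrt L / L + sqrt L) + P1 * sqrt L) * B / \<tau>\<^sup>2 * H"
    by (simp add: field_simps)
  finally show ?thesis by (simp add: B_def H_def)
qed

section \<open>The Wronskian and the Green kernels as solutions in \<open>t\<close>\<close>

text \<open>The equation has no first-order term, so the derivative cancels completely. This turns
  the \<open>t\<close>-dependent denominator of the kernels into a number.\<close>

lemma Wronskian_constant:
  assumes "is_solution L P \<tau> phi1 dphi1" "is_solution L P \<tau> phi2 dphi2"
  obtains W where "\<And>t. t \<in> {0..L} \<Longrightarrow> dphi1 t * phi2 t - phi1 t * dphi2 t = W"
proof -
  have "\<exists>W. \<forall>t\<in>{0..L}. dphi1 t * phi2 t - phi1 t * dphi2 t = W"
  proof (rule has_field_derivative_zero_constant)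
    fix t assume t: "t \<in> {0..L}"
    have d: "(phi1 has_real_derivative dphi1 t) (at t within {0..L})"
      "(dphi1 has_real_derivative (- (\<tau>\<^sup>2 / P t) * phi1 t)) (at t within {0..L})"
      "(phi2 has_real_derivative dphi2 t) (at t within {0..L})"
      "(dphi2 has_real_derivative (- (\<tau>\<^sup>2 / P t) * phi2 t)) (at t within {0..L})"
      using assms t by (auto simp: is_solution_def)
    show "((\<lambda>t. dphi1 t * phi2 t - phi1 t * dphi2 t) has_real_derivative 0) (at t within {0..L})"
      by (rule DERIV_cong[OF DERIV_diff[OF DERIV_mult[OF d(2) d(3)] DERIV_mult[OF d(1) d(4)]]])
         (simp add: algebra_simps)
  qed simp
  then show thesis using that by blast
qed

text \<open>Both kernels have this shape in \<open>t\<close>: \<alpha> and \<beta> are the values at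
  x of \<open>phi1\<close>, \<open>phi2\<close> or of their derivatives.\<close>

lemma is_solution_combination:
  assumes "is_solution L P \<tau> phi1 dphi1" "is_solution L P \<tau> phi2 dphi2"
  shows "is_solution L P \<tau> (\<lambda>t. (\<alpha> * phi2 t - \<beta> * phi1 t) / W) (\<lambda>t. (\<alpha> * dphi2 t - \<beta> * dphi1 t) / W)"
  unfolding is_solution_def
proof (intro ballI conjI)
  fix t assume t: "t \<in> {0..L}"
  have d: "(phi1 has_real_derivative dphi1 t) (at t within {0..L})"
    "(dphi1 has_real_derivative (- (\<tau>\<^sup>2 / P t) * phi1 t)) (at t within {0..L})"
    "(phi2 has_real_derivative dphi2 t) (at t within {0..L})"
    "(dphi2 has_real_derivative (- (\<tau>\<^sup>2 / P t) * phi2 t)) (at t within {0..L})"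
    using assms t by (auto simp: is_solution_def)
  show "((\<lambda>t. (\<alpha> * phi2 t - \<beta> * phi1 t) / W) has_real_derivative (\<alpha> * dphi2 t - \<beta> * dphi1 t) / W)
      (at t within {0..L})"
    by (intro DERIV_cdivide DERIV_diff DERIV_cmult d)
  have "((\<lambda>t. (\<alpha> * dphi2 t - \<beta> * dphi1 t) / W) has_real_derivative
     (\<alpha> * (- (\<tau>\<^sup>2 / P t) * phi2 t) - \<beta> * (- (\<tau>\<^sup>2 / P t) * phi1 t)) / W) (at t within {0..L})"
    by (intro DERIV_cdivide DERIV_diff DERIV_cmult d)
  then show "((\<lambda>t. (\<alpha> * dphi2 t - \<beta> * dphi1 t) / W) has_real_derivative
      - (\<tau>\<^sup>2 / P t) * ((\<alpha> * phi2 t - \<beta> * phi1 t) / W)) (at t within {0..L})"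
    by (rule DERIV_cong) (simp add: divide_simps, simp add: algebra_simps)
qed

theorem theoremB3:
  fixes L P0 P1 :: real and P :: "real \<Rightarrow> real"
  assumes "L > 0" and "P0 > 0" and "P1 > 0"
    and "C1_on_interval 0 L P"
    and "\<forall>x\<in>{0..L}. P0 \<le> P x \<and> P x \<le> P1"
  shows "\<exists>C>0. \<forall>\<tau>>1. \<forall>phi1 phi2 dphi1 dphi2 f.
     is_solution L P \<tau> phi1 dphi1 \<longrightarrow> is_solution L P \<tau> phi2 dphi2 \<longrightarrow>
     lin_indep_on L phi1 phi2 \<longrightarrow> in_H1 L f \<longrightarrow>
     (AE x in lebesgue_on {0..L}.
        \<bar>integral\<^sup>L (lebesgue_on {0..x}) (\<lambda>t. f t * greenJ phi1 phi2 dphi1 dphi2 x t)\<bar>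
          \<le> C / \<tau>\<^sup>2 * H1_norm L f)
   \<and> (AE x in lebesgue_on {0..L}.
        \<bar>integral\<^sup>L (lebesgue_on {0..x}) (\<lambda>t. f t * greenJ_dx phi1 phi2 dphi1 dphi2 x t)\<bar>
          \<le> C / \<tau> * H1_norm L f)"
proof -
  obtain P' where P': "\<And>t. t \<in> {0..L} \<Longrightarrow> (P has_real_derivative P' t) (at t within {0..L})"
      "continuous_on {0..L} P'"
    using assms(4) unfolding C1_on_interval_def by blast
  have "bounded (P' ` {0..L})"
    by (intro compact_imp_bounded compact_continuous_image P' compact_Icc)
  then obtain D where "0 < D" and D: "\<And>t. t \<in> {0..L} \<Longrightarrow> \<bar>P' t\<bar> \<le> D"
    unfolding bounded_pos by auto
  have P: "\<And>t. t \<in> {0..L} \<Longrightarrow> P0 \<le> P t \<and> P t \<le> P1" using assms(5) by blast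
  define A where "A = (2 * P1 + D * L) * (sqrt L / L + sqrt L) + P1 * sqrt L"
  \<comment> \<open>The factor \<open>sqrt P1 + 1\<close> dominates the root of the energy at
    \<open>x\<close> in both cases: \<open>sqrt P1\<close> for the first kernel, and \<tau> relative
    to \<open>q = \<tau>\<close> for the second.\<close>
  define C where "C = A * sqrt (exp (D / P0 * L) / P0) * (sqrt P1 + 1)"
  have A: "0 < A"
    unfolding A_def using assms(1,3) \<open>0 < D\<close> by (intro add_pos_pos mult_pos_pos) auto
  have C: "0 < C"
    unfolding C_def using A assms(2,3) by (intro mult_pos_pos add_pos_pos) auto
  have bound: "A * sqrt (exp (D / P0 * L) * Q / P0) \<le> C * q"
    if "0 \<le> q" "sqrt Q \<le> (sqrt P1 + 1) * q" for Q q
  proof -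
    have "A * sqrt (exp (D / P0 * L) * Q / P0) = A * sqrt (exp (D / P0 * L) / P0) * sqrt Q"
      by (simp add: real_sqrt_mult real_sqrt_divide)
    also have "\<dots> \<le> A * sqrt (exp (D / P0 * L) / P0) * ((sqrt P1 + 1) * q)"
      using that A assms(2) by (intro mult_left_mono) auto
    finally show ?thesis by (simp add: C_def mult_ac)
  qed
  \<comment> \<open>Both almost-everywhere bounds are proved at every \<open>x\<close> of the closed
    interval.\<close>
  show ?thesis
  proof (intro exI[of _ C] conjI C allI impI AE_I2)
    fix \<tau> :: real and phi1 phi2 dphi1 dphi2 f x
    assume \<tau>: "\<tau> > 1" and sol: "is_solution L P \<tau> phi1 dphi1" "is_solution L P \<tau> phi2 dphi2"
      and f: "in_H1 L f" and "x \<in> space (lebesgue_on {0..L})"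
    then have x: "x \<in> {0..L}" by simp
    then have sub: "{0..x} \<subseteq> {0..L}" by auto
    have H: "0 \<le> H1_norm L f" unfolding H1_norm_def by simp
    obtain W where W: "\<And>t. t \<in> {0..L} \<Longrightarrow> dphi1 t * phi2 t - phi1 t * dphi2 t = W"
      using Wronskian_constant[OF sol] by blast
    \<comment> \<open>One estimate for both kernels: \<open>Q\<close> bounds the energy at
      \<open>x\<close>, and \<open>q\<close>, later 1 or \<tau>, records how its root grows with
      \<tau>.\<close>
    have est: "\<bar>integral\<^sup>L (lebesgue_on {0..x}) (\<lambda>t. f t * ((\<alpha> * phi2 t - \<beta> * phi1 t) / (dphi1 t * phi2 t - phi1 t * dphi2 t)))\<bar>
        \<le> C * q / \<tau>\<^sup>2 * H1_norm L f"
      if q: "0 \<le> q" "sqrt Q \<le> (sqrt P1 + 1) * q"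
        and Q: "W \<noteq> 0 \<Longrightarrow> P x * ((\<alpha> * dphi2 x - \<beta> * dphi1 x) / W)\<^sup>2
           + \<tau>\<^sup>2 * ((\<alpha> * phi2 x - \<beta> * phi1 x) / W)\<^sup>2 \<le> Q" for \<alpha> \<beta> q Q
    proof -
      have eq: "integral\<^sup>L (lebesgue_on {0..x}) (\<lambda>t. f t * ((\<alpha> * phi2 t - \<beta> * phi1 t) / (dphi1 t * phi2 t - phi1 t * dphi2 t)))
          = integral\<^sup>L (lebesgue_on {0..x}) (\<lambda>t. f t * ((\<alpha> * phi2 t - \<beta> * phi1 t) / W))"
        using W sub by (intro Bochner_Integration.integral_cong) (auto simp: subset_iff)
      show ?thesis
      proof (cases "W = 0")
        case True
        then show ?thesis unfolding eq using C q H by simp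
      next
        case False
        have "\<bar>integral\<^sup>L (lebesgue_on {0..x}) (\<lambda>t. f t * ((\<alpha> * phi2 t - \<beta> * phi1 t) / W))\<bar>
          \<le> A * sqrt (exp (D / P0 * L) * Q / P0) / \<tau>\<^sup>2 * H1_norm L f"
          unfolding A_def
          by (rule lebesgue_integral_mult_solution_le[OF assms(1) is_solution_combination[OF sol] _ x assms(2) P P' D Q[OF False] f])
             (use \<tau> in auto)
        also have "\<dots> \<le> C * q / \<tau>\<^sup>2 * H1_norm L f"
          using bound[OF q] H by (intro mult_right_mono divide_right_mono) auto
        finally show ?thesis unfolding eq .
      qed
    qed
    have Wx: "dphi1 x * phi2 x - phi1 x * dphi2 x = W" using W[OF x] .
    show "\<bar>integral\<^sup>L (lebesgue_on {0..x}) (\<lambda>t. f t * greenJ phi1 phi2 dphi1 dphi2 x t)\<bar>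
          \<le> C / \<tau>\<^sup>2 * H1_norm L f"
    proof -
      have "P x * ((phi1 x * dphi2 x - phi2 x * dphi1 x) / W)\<^sup>2
           + \<tau>\<^sup>2 * ((phi1 x * phi2 x - phi2 x * phi1 x) / W)\<^sup>2 \<le> P1" if "W \<noteq> 0"
      proof -
        \<comment> \<open>The numerator is the Wronskian with reversed sign, so the energy at
          \<open>x\<close> is \<open>P x\<close>.\<close>
        have "(phi1 x * dphi2 x - phi2 x * dphi1 x) / W = - 1"
          using Wx that by (simp add: field_simps)
        then show ?thesis using P[OF x] by simp
      qed
      from est[OF _ _ this, of 1] show ?thesis by (simp add: greenJ_def)
    qed
    show "\<bar>integral\<^sup>L (lebesgue_on {0..x}) (\<lambda>t. f t * greenJ_dx phi1 phi2 dphi1 dphi2 x t)\<bar>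
          \<le> C / \<tau> * H1_norm L f"
    proof -
      \<comment> \<open>The first quotient is 0 and the second is 1, so the energy equals
        \<open>\<tau>\<^sup>2\<close>; its root costs one of the two factors 1/\<tau>.\<close>
      have "P x * ((dphi1 x * dphi2 x - dphi2 x * dphi1 x) / W)\<^sup>2
           + \<tau>\<^sup>2 * ((dphi1 x * phi2 x - dphi2 x * phi1 x) / W)\<^sup>2 \<le> \<tau>\<^sup>2" if "W \<noteq> 0"
        using Wx that by (simp add: mult.commute)
      moreover have "sqrt (\<tau>\<^sup>2) \<le> (sqrt P1 + 1) * \<tau>"
        using \<tau> assms(3) by (simp add: distrib_right)
      moreover have "C * \<tau> / \<tau>\<^sup>2 = C / \<tau>" using \<tau> by (simp add: power2_eq_square)
      ultimately show ?thesis using est[of \<tau> "\<tau>\<^sup>2"] \<tau> by (simp add: greenJ_dx_def)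
    qed
  qed
qed

end
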